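(* Fix $\alpha>0$ and let $X=\{(\lambda,m_\lambda)\}_{\lambda\in\Lambda}$ denote a divisor. (a) If $X$ is a sampling divisor for $\mathcal F^2_\alpha$, then $X$ satisfies the finite overlap condition and there exists $C>0$ such that $$\bigcup_{\lambda\in\Lambda} D(\lambda,\sqrt{m_\lambda/\alpha}+C)=\mathbb C.$$ (b) Conversely, let the divisor $X$ satisfy the finite overlap condition. There exists $C=C(S_X)>0$ (depending only on $S_X$) such that if for some compact subset $K$ of $\mathbb C$ we have $$\bigcup_{\lambda\in\Lambda,\ m_\lambda>\alpha C^2} D(\lambda,\sqrt{m_\lambda/\alpha}-C)=\mathbb C\setminus K,$$ then $X$ is a sampling divisor for $\mathcal F^2_\alpha$.
   Context: $D(z,r)$ is the open disc of radius $r$ centered at $z\in\mathbb C$; $dm$ is Lebesgue area measure. For $\alpha>0$, $\mathcal F^2_\alpha$ is the Hilbert space of entire functions $f$ with $\|f\|_2^2=\frac{\alpha}{\pi}\int_{\mathbb C}|f(z)|^2e^{-\alpha|z|^2}dm(z)<\infty$, with inner product $\langle f,g\rangle=\frac{\alpha}{\pi}\int_{\mathbb C} f\overline g\, e^{-\alpha|z|^2}dm$. Its monomial orthonormal basis is $e_k(z)=\sqrt{\alpha^k/k!}\,z^k$, $k\ge 0$. For $\lambda\in\mathbb C$, the translation $T_\lambda f(\zeta)=e^{\alpha\bar\lambda\zeta-\frac{\alpha}{2}|\lambda|^2}f(\zeta-\lambda)$ acts isometrically on $\mathcal F^2_\alpha$. A divisor is $X=\{(\lambda,m_\lambda)\}_{\lambda\in\Lambda}$,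 where $\Lambda$ is a sequence of (distinct) points in $\mathbb C$ and $m_\lambda\in\{1,2,3,\dots\}$ is the multiplicity associated with $\lambda$. Put $N^2_\lambda=\{f\in\mathcal F^2_\alpha: f(\lambda)=f'(\lambda)=\dots=f^{(m_\lambda-1)}(\lambda)=0\}$. $X$ is called sampling for $\mathcal F^2_\alpha$ if there are constants $0<c\le C'<\infty$ such that for all $f\in\mathcal F^2_\alpha$, $c\|f\|_2^2\le \sum_{\lambda\in\Lambda}\|f\|^2_{\mathcal F^2_\alpha/N^2_\lambda}\le C'\|f\|_2^2$, where $\|f\|^2_{\mathcal F^2_\alpha/N^2_\lambda}=\sum_{k=0}^{m_\lambda-1}|\langle f,T_\lambda e_k\rangle|^2$ is the squared quotient norm. $X$ satisfies the finite overlap condition if $S_X=\sup_{z\in\mathbb C}\sum_{\lambda\in\Lambda}\chi_{D(\lambda,\sqrt{m_\lambda/\alpha})}(z)<\infty$. *)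

theory Defs
  imports "HOL-Analysis.Analysis" "HOL-Complex_Analysis.Complex_Analysis"
begin

definition fock :: "real \<Rightarrow> (complex \<Rightarrow> complex) set" where
  "fock \<alpha> = {f. f holomorphic_on UNIV \<and>
     integrable lborel (\<lambda>z. (norm (f z))\<^sup>2 * exp (- \<alpha> * (norm z)\<^sup>2))}"

definition fock_norm2 :: "real \<Rightarrow> (complex \<Rightarrow> complex) \<Rightarrow> real" where
  "fock_norm2 \<alpha> f =
     \<alpha> / pi * (LINT z|lborel. (norm (f z))\<^sup>2 * exp (- \<alpha> * (norm z)\<^sup>2))"

definition fock_inner :: "real \<Rightarrow> (complex \<Rightarrow> complex) \<Rightarrow> (complex \<Rightarrow> complex) \<Rightarrow> complex" where
  "fock_inner \<alpha> f g = complex_of_real (\<alpha> / pi) *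
     (LINT z|lborel. f z * cnj (g z) * complex_of_real (exp (- \<alpha> * (norm z)\<^sup>2)))"

definition fock_basis :: "real \<Rightarrow> nat \<Rightarrow> complex \<Rightarrow> complex" where
  "fock_basis \<alpha> k z = complex_of_real (sqrt (\<alpha> ^ k / fact k)) * z ^ k"

definition fock_translation ::
  "real \<Rightarrow> complex \<Rightarrow> (complex \<Rightarrow> complex) \<Rightarrow> complex \<Rightarrow> complex" where
  "fock_translation \<alpha> l f \<zeta> =
     exp (complex_of_real \<alpha> * cnj l * \<zeta> - complex_of_real (\<alpha> / 2 * (norm l)\<^sup>2)) * f (\<zeta> - l)"

text \<open>The squared norm of the class of \<open>f\<close> in the quotient of the Fock space by the functions
  vanishing at \<open>l\<close> to order at least \<open>n\<close>, in terms of the translated monomials.\<close>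

definition quotient_norm2 :: "real \<Rightarrow> complex \<Rightarrow> nat \<Rightarrow> (complex \<Rightarrow> complex) \<Rightarrow> real" where
  "quotient_norm2 \<alpha> l n f =
     (\<Sum>k<n. (norm (fock_inner \<alpha> f (fock_translation \<alpha> l (fock_basis \<alpha> k))))\<^sup>2)"

text \<open>A divisor is given by its countable set \<open>\<Lambda>\<close> of points (a sequence of distinct points) and a
  multiplicity function \<open>m\<close>, whose values outside \<open>\<Lambda>\<close> are irrelevant.\<close>

definition divisor :: "complex set \<Rightarrow> (complex \<Rightarrow> nat) \<Rightarrow> bool" where
  "divisor \<Lambda> m \<longleftrightarrow> countable \<Lambda> \<and> (\<forall>l\<in>\<Lambda>. 1 \<le> m l)"

text \<open>The sums over \<open>\<Lambda>\<close> are taken in \<^typ>\<open>ennreal\<close>, so that divergent sums have the value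
  \<open>\<infinity>\<close> rather than the junk value \<open>0\<close>.\<close>

definition sampling_divisor :: "real \<Rightarrow> complex set \<Rightarrow> (complex \<Rightarrow> nat) \<Rightarrow> bool" where
  "sampling_divisor \<alpha> \<Lambda> m \<longleftrightarrow> divisor \<Lambda> m \<and>
     (\<exists>c C'. 0 < c \<and> c \<le> C' \<and> (\<forall>f\<in>fock \<alpha>.
        ennreal (c * fock_norm2 \<alpha> f) \<le> (\<Sum>\<^sub>\<infinity>l\<in>\<Lambda>. ennreal (quotient_norm2 \<alpha> l (m l) f)) \<and>
        (\<Sum>\<^sub>\<infinity>l\<in>\<Lambda>. ennreal (quotient_norm2 \<alpha> l (m l) f)) \<le> ennreal (C' * fock_norm2 \<alpha> f)))"

definition overlap :: "real \<Rightarrow> complex set \<Rightarrow> (complex \<Rightarrow> nat) \<Rightarrow> ennreal" where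
  "overlap \<alpha> \<Lambda> m = (SUP z. \<Sum>\<^sub>\<infinity>l\<in>\<Lambda>. indicator (ball l (sqrt (real (m l) / \<alpha>))) z)"

definition finite_overlap :: "real \<Rightarrow> complex set \<Rightarrow> (complex \<Rightarrow> nat) \<Rightarrow> bool" where
  "finite_overlap \<alpha> \<Lambda> m \<longleftrightarrow> overlap \<alpha> \<Lambda> m < \<infinity>"

end

theory Submission
  imports Defs
begin

text \<open>In the basis of translated monomials at \<open>l\<close>, the mass of \<open>f\<close> on the disc of radius \<open>r\<close> around \<open>l\<close>
  is \<open>\<Sum>k. |a\<^sub>k|\<^sup>2 P(Poisson(\<alpha> r\<^sup>2) > k)\<close>, while the quotient norm is \<open>\<Sum>k<m. |a\<^sub>k|\<^sup>2\<close>. With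
  \<open>R = sqrt (m / \<alpha>)\<close>, the bound \<open>P(Poisson(m) \<ge> m) \<ge> 1/2\<close> dominates the quotient norm by twice the mass
  of the disc of radius \<open>R\<close>, and for \<open>k \<ge> m - 1\<close> the Poisson tails for \<open>\<alpha> (R - C)\<^sup>2\<close> are at most
  \<open>exp (- 2 \<alpha> C\<^sup>2)\<close> times those for \<open>\<alpha> R\<^sup>2\<close>.

  For (a), test on normalized reproducing kernels, whose quotient norms are Poisson probabilities:
  \<open>P(Poisson(m) < m) \<ge> 1/e\<close> gives the finite overlap, and the Gaussian decay of the kernel away from its
  centre gives the covering. For (b), summing the local estimates bounds \<open>\<parallel>f\<parallel>\<^sup>2\<close> by the quotient norms
  plus the mass on \<open>K\<close>. A normal families argument removes the latter, provided that no nonzero \<open>f\<close>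
  vanishes on the whole divisor; for such an \<open>f\<close>, dividing out a far away zero shows that \<open>z f\<close> is again
  in the space, and then the functions \<open>z\<^sup>p f\<close> keep half of their mass on \<open>K\<close> for all \<open>p\<close>, which is
  impossible.\<close>

text \<open>Multiplicities are unbounded, so no constant may depend on them; this is why the local
  estimates are reduced to Poisson bounds that are uniform in \<open>m\<close>. The condition on
  \<open>C\<close> comes from summation: shrinking every large disc by \<open>C\<close> costs an
  error of \<open>exp (- 2 * \<alpha> * C^2)\<close> times the mass of the full disc, and at most
  \<open>S\<close> full discs overlap, so the total error can be absorbed on the left once
  \<open>S * exp (- 2 * \<alpha> * C^2)\<close> is at most 1/2. The choice
  \<open>\<alpha> * C^2 = S + 1\<close> achieves this. The obstacle in (b) is uniqueness: for a null
  function \<open>f\<close>, nothing says a priori that \<open>z * f z\<close> has finite norm. The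
  absorbed inequality helps, since it bounds the whole norm of a null function by its mass on
  \<open>K\<close>. It survives the loss of one order of vanishing at a point, so a quotient in
  which one zero has been traded for the factor \<open>z\<close> is still controlled by its size on
  \<open>K\<close>, uniformly in the position of that zero.\<close>

section \<open>Poisson tails\<close>

text \<open>The probability of a value strictly below \<open>n\<close>.\<close>

definition poisson_cdf :: "nat \<Rightarrow> real \<Rightarrow> real" where
  "poisson_cdf n x = exp (- x) * (\<Sum>j<n. x ^ j / fact j)"

lemma poisson_cdf_0 [simp]: "poisson_cdf 0 x = 0"
  by (simp add: poisson_cdf_def)

lemma poisson_cdf_Suc: "poisson_cdf (Suc n) x = poisson_cdf n x + exp (- x) * (x ^ n / fact n)"
  by (simp add: poisson_cdf_def algebra_simps)

lemma poisson_cdf_at_0: "poisson_cdf (Suc n) 0 = 1"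
  by (induction n) (simp_all add: poisson_cdf_Suc)

text \<open>The derivative of a Poisson weight is the difference of two consecutive weights, so the
  sum telescopes to its last term. Read backwards, Poisson tails are the incomplete Gamma integrals
  that radial Gaussian integration produces.\<close>

lemma DERIV_poisson_cdf:
  "(poisson_cdf (Suc n) has_real_derivative - (x ^ n * exp (- x) / fact n)) (at x)"
proof (induction n)
  case 0
  have "poisson_cdf (Suc 0) = (\<lambda>x. exp (- x))"
    by (simp add: fun_eq_iff poisson_cdf_def)
  then show ?case by (auto intro!: derivative_eq_intros)
next
  case (Suc n)
  have eq: "poisson_cdf (Suc (Suc n)) =
      (\<lambda>x. poisson_cdf (Suc n) x + exp (- x) * (x ^ Suc n / fact (Suc n)))"
    by (simp add: fun_eq_iff poisson_cdf_Suc)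
  have s: "(1 + real n) * x ^ n / (fact n + real n * fact n) = x ^ n / fact n"
  proof -
    have "fact n + real n * fact n = (1 + real n) * fact n" by (simp add: algebra_simps)
    moreover have "1 + real n \<noteq> 0" by (simp add: add_pos_nonneg less_imp_neq)
    ultimately show ?thesis by simp
  qed
  show ?case unfolding eq
    by (rule derivative_eq_intros Suc refl | simp)+
qed

lemma poisson_cdf_nonneg: "0 \<le> x \<Longrightarrow> 0 \<le> poisson_cdf n x"
  by (simp add: poisson_cdf_def sum_nonneg)

lemma poisson_cdf_mono: "m \<le> n \<Longrightarrow> 0 \<le> x \<Longrightarrow> poisson_cdf m x \<le> poisson_cdf n x"
  unfolding poisson_cdf_def by (intro mult_left_mono sum_mono2) auto

lemma poisson_cdf_le_1: "0 \<le> x \<Longrightarrow> poisson_cdf n x \<le> 1"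
proof -
  assume "0 \<le> x"
  then have "(\<Sum>j<n. x ^ j / fact j) \<le> (\<Sum>j. x ^ j / fact j)"
    using summable_exp[of x] by (intro sum_le_suminf) (auto simp: field_simps)
  also have "\<dots> = exp x" by (simp add: exp_def field_simps)
  finally show ?thesis by (simp add: poisson_cdf_def exp_minus field_simps)
qed

lemma poisson_cdf_antimono: "0 \<le> x \<Longrightarrow> x \<le> y \<Longrightarrow> poisson_cdf n y \<le> poisson_cdf n x"
proof (cases n)
  case (Suc k)
  assume *: "0 \<le> x" "x \<le> y"
  show ?thesis unfolding Suc
    by (rule DERIV_nonpos_imp_nonincreasing[OF *(2)])
       (use * DERIV_poisson_cdf in \<open>auto intro!: exI\<close>)
qed simp

text \<open>For the weights \<open>p\<close> of Poisson(\<open>m\<close>) and \<open>Q = \<Sum>k<m. p k\<close>, telescoping gives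
  \<open>\<Sum>k<m. (m - k) p k = m p (m - 1)\<close> and \<open>\<Sum>k<m. (m - k)\<^sup>2 p k = m Q\<close>, so \<open>m (p (m - 1))\<^sup>2 \<le> Q\<^sup>2\<close> by
  Cauchy-Schwarz; the left-hand side increases with \<open>m\<close>.\<close>

lemma poisson_cdf_ge_inverse_exp:
  assumes "1 \<le> m"
  shows "exp (- 1) \<le> poisson_cdf m (real m)"
proof -
  define p where "p k = exp (- real m) * (real m ^ k / fact k)" for k
  have p0: "p k \<ge> 0" for k by (simp add: p_def)
  have pS: "real (Suc k) * p (Suc k) = real m * p k" for k
    by (simp add: p_def divide_simps) (simp add: algebra_simps)?
  define Q where "Q = (\<Sum>k<m. p k)"
  have Q: "Q = poisson_cdf m (real m)"
    by (simp add: Q_def p_def poisson_cdf_def sum_distrib_left)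
  have sum1: "(\<Sum>k<n. (real m - real k) * p k) = (if n = 0 then 0 else real m * p (n - 1))" for n
  proof (induction n)
    case (Suc n)
    then show ?case by (cases n) (use pS in \<open>auto simp: algebra_simps\<close>)
  qed simp
  \<comment> \<open>Both sums run to an arbitrary \<open>n\<close> so that induction applies; the
    boundary term here vanishes at \<open>n = m\<close>.\<close>
  have sum2: "(\<Sum>k<n. (real m - real k)\<^sup>2 * p k)
      = real m * (\<Sum>k<n. p k) + (if n = 0 then 0 else real m * (real m - real n) * p (n - 1))" for n
  proof (induction n)
    case (Suc n)
    show ?case
    proof (cases n)
      case 0 then show ?thesis by (simp add: power2_eq_square algebra_simps)
    next
      case (Suc j)
      have *: "(real m - real n)\<^sup>2 * p n = (real m - real n) * (real m * p n - real m * p j)"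
      proof -
        have "(real m - real n) * p n = real m * p n - real m * p j"
          using pS[of j] Suc by (simp add: algebra_simps)
        then show ?thesis by (simp add: power2_eq_square mult.assoc)
      qed
      show ?thesis unfolding sum.lessThan_Suc Suc.IH * by (simp add: Suc algebra_simps)
    qed
  qed simp
  have sq: "sqrt (p k) * ((real m - real k) * sqrt (p k)) = (real m - real k) * p k" for k
    using p0 by (simp add: mult.left_commute)
  have "(real m * p (m - 1))\<^sup>2 = (\<Sum>k<m. sqrt (p k) * ((real m - real k) * sqrt (p k)))\<^sup>2"
    unfolding sq using sum1[of m] assms by simp
  also have "\<dots> \<le> (\<Sum>k<m. (sqrt (p k))\<^sup>2) * (\<Sum>k<m. ((real m - real k) * sqrt (p k))\<^sup>2)"
    by (rule Cauchy_Schwarz_ineq_sum)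
  also have "\<dots> = real m * Q\<^sup>2"
  proof -
    have "((real m - real k) * sqrt (p k))\<^sup>2 = (real m - real k)\<^sup>2 * p k" for k
      using p0 by (simp add: power_mult_distrib)
    then show ?thesis using sum2[of m] p0 assms by (simp add: Q_def power2_eq_square[of "sum p _"])
  qed
  finally have *: "real m * (p (m - 1))\<^sup>2 \<le> Q\<^sup>2"
    using assms by (simp add: power_mult_distrib power2_eq_square mult_ac)
  \<comment> \<open>The quantity \<open>m * (p (m - 1))^2\<close>, where \<open>p\<close> itself
    depends on \<open>m\<close>, grows from \<open>m = n\<close> to \<open>m = n + 1\<close> by the
    factor \<open>(1 + 1 / n) ^ (2 * n + 1) * exp (- 2)\<close>.\<close>
  have step: "exp 2 \<le> (1 + 1 / real n) ^ (2 * n + 1)" if "n \<ge> 1" for n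
  proof -
    have "2 / (2 * real n + 1) \<le> ln (1 + 1 / real n)"
      using ln_inverse_approx_ge[of "real n" "real n + 1"] that ln_div[of "real n + 1" "real n"]
      by (simp add: add_divide_distrib)
    then have "2 \<le> real (2 * n + 1) * ln (1 + 1 / real n)"
      by (simp add: field_simps)
    then have "exp 2 \<le> exp (real (2 * n + 1) * ln (1 + 1 / real n))" by (simp only: exp_le_cancel_iff)
    also have "\<dots> = (1 + 1 / real n) ^ (2 * n + 1)"
      using that by (subst exp_of_nat_mult) (simp add: add_pos_nonneg)
    finally show ?thesis .
  qed
  \<comment> \<open>Here \<open>n\<close> stands for \<open>m - 1\<close>; the start
    \<open>n = 0\<close> gives exactly \<open>exp (- 2)\<close>.\<close>
  have "exp (- 2) \<le> real (Suc n) * (exp (- real (Suc n)) * (real (Suc n) ^ n / fact n))\<^sup>2" for n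
  proof (induction n)
    case 0
    then show ?case by (simp add: power2_eq_square flip: exp_add)
  next
    case (Suc n)
    define N where "N = real (Suc n)"
    define b where "b = exp (- N) * (N ^ n / fact n)"
    have N: "N > 0" "real (Suc (Suc n)) = N * (1 + 1 / N)" "fact (Suc n) = N * fact n"
      by (auto simp: N_def field_simps)
    have "N * b\<^sup>2 * 1 \<le> N * b\<^sup>2 * ((1 + 1 / N) ^ (2 * Suc n + 1) * exp (- 2))"
    proof (rule mult_left_mono)
      show "1 \<le> (1 + 1 / N) ^ (2 * Suc n + 1) * exp (- 2)"
        using mult_right_mono[OF step[of "Suc n"], of "exp (- 2)"] unfolding N_def
        by (simp flip: exp_add)
    qed (use N in simp)
    also have "\<dots> = N * (1 + 1 / N) * (b * ((1 + 1 / N) ^ Suc n * exp (- 1)))\<^sup>2"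
      by (simp add: power_mult_distrib power_add power_mult power2_eq_square mult_exp_exp
        power_mult[symmetric] mult_2 flip: exp_double)
    also have "b * ((1 + 1 / N) ^ Suc n * exp (- 1))
        = exp (- (N + 1)) * ((N * (1 + 1 / N)) ^ Suc n / fact (Suc n))"
    proof -
      have "b * (y ^ Suc n * exp (- 1)) = exp (- (N + 1)) * ((N * y) ^ Suc n / fact (Suc n))" for y
        unfolding N(3) using N(1) by (simp add: b_def power_mult_distrib exp_diff exp_minus divide_inverse mult_ac)
      then show ?thesis by blast
    qed
    also have "N + 1 = N * (1 + 1 / N)" using N(1) by (simp add: field_simps)
    finally have "N * b\<^sup>2 \<le> N * (1 + 1 / N) * (exp (- (N * (1 + 1 / N)))
        * ((N * (1 + 1 / N)) ^ Suc n / fact (Suc n)))\<^sup>2" by simp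
    moreover have "exp (- 2) \<le> N * b\<^sup>2" using Suc by (simp only: b_def N_def)
    ultimately show ?case unfolding N(2) by (rule order_trans[rotated])
  qed
  from this[of "m - 1"] have "exp (- 2) \<le> real m * (p (m - 1))\<^sup>2"
    using assms by (simp add: p_def)
  then have "(exp (- 1))\<^sup>2 \<le> Q\<^sup>2"
    using * by (simp add: power2_eq_square flip: exp_add)
  moreover have "0 \<le> Q" by (simp add: Q_def p0 sum_nonneg)
  ultimately show ?thesis unfolding Q by (rule power2_le_imp_le)
qed

text \<open>Reflection about \<open>m - 1/2\<close>: \<open>p (m - 1 - j) \<le> p (m + j)\<close>.\<close>

lemma poisson_cdf_le_half:
  assumes "1 \<le> m"
  shows "poisson_cdf m (real m) \<le> 1 / 2"
proof -
  define p where "p k = exp (- real m) * (real m ^ k / fact k)" for k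
  have p0: "p k \<ge> 0" for k by (simp add: p_def)
  have pS: "real (Suc k) * p (Suc k) = real m * p k" for k
    by (simp add: p_def divide_simps) (simp add: algebra_simps)?
  have cdf: "poisson_cdf n (real m) = (\<Sum>k<n. p k)" for n
    by (simp add: p_def poisson_cdf_def sum_distrib_left)
  have le: "p (m - 1 - j) \<le> p (m + j)" if "j < m" for j
    using that
  proof (induction j)
    case 0
    show ?case using pS[of "m - 1"] assms by simp
  next
    case (Suc j)
    have *: "p (m - 1 - j) \<le> p (m + j)" using Suc by simp
    define i where "i = m - 1 - Suc j"
    have i: "m - 1 - j = Suc i" "real m = real i + real j + 2"
      using Suc.prems by (auto simp: i_def of_nat_diff)
    have "real m * p i = real (Suc i) * p (Suc i)" using pS[of i] by simp
    also have "\<dots> \<le> real (Suc i) * p (m + j)" using * i by (intro mult_left_mono) auto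
    finally have "real m * (real m * p i) \<le> real m * (real (Suc i) * p (m + j))"
      by (intro mult_left_mono) auto
    also have "\<dots> = real (Suc i) * real (Suc (m + j)) * p (Suc (m + j))"
      using pS[of "m + j"] by (simp only: mult_ac)
    \<comment> \<open>The two factors are \<open>m - (j + 1)\<close> and \<open>m + (j + 1)\<close>,
      so their product is at most \<open>m^2\<close>.\<close>
    also have "\<dots> \<le> (real m * real m) * p (Suc (m + j))"
      using i p0 by (intro mult_right_mono) (auto simp: algebra_simps)
    finally show ?case using assms by (simp add: i_def)
  qed
  have "(\<Sum>k<m. p k) = (\<Sum>j<m. p (m - 1 - j))"
    by (subst sum.nat_diff_reindex[symmetric]) simp
  also have "\<dots> \<le> (\<Sum>j<m. p (m + j))" by (intro sum_mono le) auto
  finally have "(\<Sum>k<m. p k) \<le> (\<Sum>j<m. p (m + j))" .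
  then have "2 * (\<Sum>k<m. p k) \<le> (\<Sum>k<m. p k) + (\<Sum>j<m. p (m + j))" by simp
  also have "\<dots> = (\<Sum>k<m + m. p k)"
    using sum.atLeastLessThan_concat[of 0 m "m + m" p] sum.shift_bounds_nat_ivl[of p 0 m m]
    by (simp add: lessThan_atLeast0 add.commute)
  also have "\<dots> \<le> 1" using poisson_cdf_le_1[of "real m" "m + m"] by (simp add: cdf)
  finally show ?thesis by (simp add: cdf)
qed

text \<open>The tail at \<open>x\<close> is the integral of \<open>t ^ k * exp (- t) / fact k\<close> over \<open>{0..x}\<close>; substitute \<open>q * t\<close>.\<close>

lemma poisson_tail_scale:
  assumes "0 < x" "1 \<le> q"
  shows "q ^ Suc k * exp (- ((q - 1) * x)) * (1 - poisson_cdf (Suc k) x)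
           \<le> 1 - poisson_cdf (Suc k) (q * x)"
proof -
  define F where "F t = (1 - poisson_cdf (Suc k) (q * t))
      - q ^ Suc k * exp (- ((q - 1) * x)) * (1 - poisson_cdf (Suc k) t)" for t
  have D: "(F has_real_derivative
      q ^ Suc k * (t ^ k * exp (- t) / fact k) * (exp (- ((q - 1) * t)) - exp (- ((q - 1) * x)))) (at t)" for t
  proof -
    have e: "exp (- (q * t)) = exp (- t) * exp (- ((q - 1) * t))"
      by (simp add: algebra_simps flip: exp_add)
    have 1: "((\<lambda>t. poisson_cdf (Suc k) (q * t)) has_real_derivative
        - ((q * t) ^ k * exp (- (q * t)) / fact k) * q) (at t)"
      by (rule DERIV_chain2[OF DERIV_poisson_cdf]) (auto intro!: derivative_eq_intros)
    show ?thesis unfolding F_def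
      by (rule derivative_eq_intros 1 DERIV_poisson_cdf refl)+
         (simp add: e power_mult_distrib field_simps)
  qed
  \<comment> \<open>For \<open>t <= x\<close> the last factor of the derivative is nonnegative, and
    at 0 both tails vanish.\<close>
  have "F 0 \<le> F x"
  proof (rule DERIV_nonneg_imp_nondecreasing[of 0 x F])
    fix t assume "0 \<le> t" "t \<le> x"
    then show "\<exists>y. (F has_real_derivative y) (at t) \<and> 0 \<le> y"
      using assms
      by (intro exI[of _ "q ^ Suc k * (t ^ k * exp (- t) / fact k)
            * (exp (- ((q - 1) * t)) - exp (- ((q - 1) * x)))"] conjI D mult_nonneg_nonneg)
         (auto intro!: mult_left_mono)
  qed (use assms in simp)
  then show ?thesis by (simp add: F_def poisson_cdf_at_0)
qed

text \<open>The quadratic term is kept because in the tail comparison the linear terms cancel; it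
  supplies half of the exponent \<open>2 * c^2\<close>.\<close>

lemma ln_one_minus_upper:
  assumes "0 \<le> u" "u < (1::real)"
  shows "ln (1 - u) \<le> - u - u\<^sup>2 / 2"
proof -
  have "ln (1 - u) + u + u\<^sup>2 / 2 \<le> ln (1 - 0) + 0 + 0\<^sup>2 / 2"
  proof (rule DERIV_nonpos_imp_nonincreasing[of 0 u "\<lambda>u. ln (1 - u) + u + u\<^sup>2 / 2"])
    fix x :: real assume x: "0 \<le> x" "x \<le> u"
    then have "1 - x > 0" using assms by simp
    moreover from this x have "- (1 / (1 - x)) + 1 + x \<le> 0" by (simp add: field_simps)
    ultimately show "\<exists>y. ((\<lambda>u. ln (1 - u) + u + u\<^sup>2 / 2) has_real_derivative y) (at x) \<and> y \<le> 0"
      by (intro exI[of _ "- (1 / (1 - x)) + 1 + x"] conjI) (auto intro!: derivative_eq_intros)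
  qed (use assms in simp)
  then show ?thesis by simp
qed

text \<open>Scaling by \<open>q = m / x\<close> gains the factor
  \<open>q ^ Suc k * exp (- ((q - 1) * x))\<close>, and since \<open>q >= 1\<close> and
  \<open>m <= Suc k\<close> the power is at least \<open>q ^ m\<close>. With
  \<open>u = c / sqrt m\<close>, the logarithm of the resulting factor is at least
  \<open>(2 * m * u + c^2) - (2 * m * u - c^2) = 2 * c^2\<close>, uniformly in \<open>m\<close> and
  \<open>k\<close>.\<close>

lemma poisson_tail_shrink:
  assumes "0 < c" "c < sqrt (real m)" "m \<le> Suc k"
  shows "1 - poisson_cdf (Suc k) ((sqrt (real m) - c)\<^sup>2)
           \<le> exp (- 2 * c\<^sup>2) * (1 - poisson_cdf (Suc k) (real m))"
proof -
  define s where "s = sqrt (real m)"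
  define x where "x = (s - c)\<^sup>2"
  define q where "q = real m / x"
  define u where "u = c / s"
  have s: "c < s" "s\<^sup>2 = real m" using assms by (auto simp: s_def)
  then have "s > 0" "real m > 0" using assms(1) by (auto simp flip: s(2))
  note s = this s
  have x: "0 < x" "x \<le> real m"
    using s assms unfolding x_def s(4)[symmetric] by (auto intro!: power_mono zero_less_power)
  have q: "1 \<le> q" "q * x = real m" using x by (auto simp: q_def)
  have u: "0 < u" "u < 1" "x = real m * (1 - u)\<^sup>2" "real m * u\<^sup>2 = c\<^sup>2"
    using s assms unfolding u_def x_def s(4)[symmetric]
    by (auto simp: power_divide field_simps power2_eq_square)
  have lnu: "ln (1 - u) \<le> - u - u\<^sup>2 / 2"
    by (rule ln_one_minus_upper) (use u in auto)
  have lnq: "ln q = - 2 * ln (1 - u)"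
    using u s x by (simp add: q_def u(3) ln_div ln_mult ln_realpow)
  have "2 * c\<^sup>2 \<le> real m * ln q - (q - 1) * x"
  proof -
    have "real m * (2 * u + u\<^sup>2) \<le> real m * ln q"
      unfolding lnq using lnu by (intro mult_left_mono) auto
    then have "2 * (real m * u) + c\<^sup>2 \<le> real m * ln q"
      using u(4) by (simp add: algebra_simps)
    moreover have "(q - 1) * x = real m - x" using q by (simp add: left_diff_distrib)
    moreover have "x = real m - 2 * (real m * u) + c\<^sup>2"
      unfolding u(3) u(4)[symmetric] by (simp add: power2_eq_square algebra_simps)
    ultimately show ?thesis by linarith
  qed
  then have "exp (2 * c\<^sup>2) \<le> exp (real m * ln q) * exp (- ((q - 1) * x))"
    by (simp flip: exp_add)
  also have "exp (real m * ln q) = q ^ m"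
    using q by (simp add: exp_of_nat_mult)
  also have "q ^ m * exp (- ((q - 1) * x)) \<le> q ^ Suc k * exp (- ((q - 1) * x))"
    using q assms by (intro mult_right_mono power_increasing) auto
  finally have "exp (2 * c\<^sup>2) * (1 - poisson_cdf (Suc k) x)
      \<le> q ^ Suc k * exp (- ((q - 1) * x)) * (1 - poisson_cdf (Suc k) x)"
    using x poisson_cdf_le_1[of x "Suc k"] by (intro mult_right_mono) auto
  also have "\<dots> \<le> 1 - poisson_cdf (Suc k) (real m)"
    using poisson_tail_scale[OF x(1) q(1), of k] q by simp
  finally show ?thesis
    by (simp add: x_def s_def exp_minus field_simps)
qed

lemma tendsto_poisson_cdf: "(poisson_cdf k \<longlongrightarrow> 0) at_top"
proof -
  have "((\<lambda>x. \<Sum>j<k. x ^ j / exp x / fact j) \<longlongrightarrow> (\<Sum>j<k. 0 / fact j)) (at_top :: real filter)"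
    by (intro tendsto_sum tendsto_divide tendsto_power_div_exp_0 tendsto_const) auto
  moreover have "poisson_cdf k = (\<lambda>x. \<Sum>j<k. x ^ j / exp x / fact j)"
    by (simp add: fun_eq_iff poisson_cdf_def sum_distrib_left exp_minus field_simps)
  ultimately show ?thesis by simp
qed

section \<open>Rotation invariance and radial integrals on the plane\<close>

lemma nn_integral_lborel_shift:
  fixes c :: "'a::euclidean_space" and F :: "'a \<Rightarrow> ennreal"
  assumes "F \<in> borel_measurable borel"
  shows "(\<integral>\<^sup>+x. F (c + x) \<partial>lborel) = (\<integral>\<^sup>+x. F x \<partial>lborel)"
  by (subst (2) lborel_distr_plus[of c, symmetric]) (simp add: nn_integral_distr assms)

text \<open>Fubini for \<open>F (u * x) * indicator (ball 0 1) (y - u * x)\<close>: the unit disc is rotation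
  invariant and has positive finite measure.\<close>

lemma nn_integral_lborel_rotate:
  fixes F :: "complex \<Rightarrow> ennreal"
  assumes [measurable]: "F \<in> borel_measurable borel" and u: "norm u = 1"
  shows "(\<integral>\<^sup>+x. F (u * x) \<partial>lborel) = (\<integral>\<^sup>+x. F x \<partial>lborel)"
proof -
  define B :: "complex \<Rightarrow> ennreal" where "B = indicator (ball 0 1)"
  have [measurable]: "B \<in> borel_measurable borel" unfolding B_def by (intro borel_measurable_indicator) simp
  have [measurable]: "(\<lambda>x. u * x) \<in> borel_measurable borel" by simp
  have Bu: "B (- (u * x)) = B x" for x by (simp add: B_def indicator_def norm_mult u)
  have u1: "u * (cnj u * y) = y" for y
    using u by (simp add: mult.assoc[symmetric] complex_norm_square[symmetric])
  define b where "b = (\<integral>\<^sup>+y. B y \<partial>lborel)"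
  have b: "b = emeasure lborel (ball (0::complex) 1)"
    unfolding b_def B_def by simp
  have "b \<noteq> 0" "b \<noteq> \<infinity>"
    unfolding b using emeasure_lborel_ball_finite[of "0::complex" 1]
    by (auto simp: emeasure_ball unit_ball_vol_2)
  have "(\<integral>\<^sup>+x. F (u * x) \<partial>lborel) * b = (\<integral>\<^sup>+x. (\<integral>\<^sup>+y. F (u * x) * B (- (u * x) + y) \<partial>lborel) \<partial>lborel)"
  proof -
    have "(\<integral>\<^sup>+y. F (u * x) * B (- (u * x) + y) \<partial>lborel) = F (u * x) * b" for x
      using nn_integral_lborel_shift[of B "- (u * x)"] by (subst nn_integral_cmult) (simp_all add: b_def)
    then show ?thesis by (simp add: nn_integral_multc)
  qed
  also have "\<dots> = (\<integral>\<^sup>+y. (\<integral>\<^sup>+x. F (u * x) * B (- (u * x) + y) \<partial>lborel) \<partial>lborel)"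
    by (rule lborel_pair.Fubini') measurable
  \<comment> \<open>The shift by \<open>cnj u * y\<close> replaces \<open>u * x\<close> by
    \<open>u * x + y\<close>, because \<open>u * cnj u = 1\<close>.\<close>
  also have "\<dots> = (\<integral>\<^sup>+y. (\<integral>\<^sup>+x. F (u * (cnj u * y + x)) * B (- (u * (cnj u * y + x)) + y) \<partial>lborel) \<partial>lborel)"
    by (subst nn_integral_lborel_shift[of "\<lambda>x. F (u * x) * B (- (u * x) + _)"]) simp_all
  also have "\<dots> = (\<integral>\<^sup>+y. (\<integral>\<^sup>+x. F (u * x + y) * B x \<partial>lborel) \<partial>lborel)"
  proof -
    have "u * (cnj u * y + x) = u * x + y" "B (- (u * (cnj u * y + x)) + y) = B x" for x y
      using Bu[of x] by (simp_all add: distrib_left u1)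
    then show ?thesis by simp
  qed
  also have "\<dots> = (\<integral>\<^sup>+x. (\<integral>\<^sup>+y. F (u * x + y) * B x \<partial>lborel) \<partial>lborel)"
    by (rule lborel_pair.Fubini') measurable
  also have "\<dots> = (\<integral>\<^sup>+y. F y \<partial>lborel) * b"
  proof -
    have "(\<integral>\<^sup>+y. F (u * x + y) * B x \<partial>lborel) = (\<integral>\<^sup>+y. F y \<partial>lborel) * B x" for x
      using nn_integral_lborel_shift[of F "u * x"] by (simp add: nn_integral_multc)
    then show ?thesis by (simp add: nn_integral_cmult b_def)
  qed
  finally show ?thesis
    using \<open>b \<noteq> 0\<close> \<open>b \<noteq> \<infinity>\<close> by (simp add: ennreal_mult_cancel_left mult.commute[of _ b])
qed

lemma lborel_distr_rotate:
  fixes u :: complex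
  assumes "norm u = 1"
  shows "distr lborel borel ((*) u) = lborel"
proof (rule measure_eqI)
  fix A :: "complex set" assume "A \<in> sets (distr lborel borel ((*) u))"
  then have [measurable]: "A \<in> sets borel" by simp
  have "emeasure (distr lborel borel ((*) u)) A = (\<integral>\<^sup>+x. indicator A x \<partial>distr lborel borel ((*) u))"
    by simp
  also have "\<dots> = (\<integral>\<^sup>+x. indicator A (u * x) \<partial>lborel)"
    by (rule nn_integral_distr) simp_all
  also have "\<dots> = emeasure lborel A"
    using nn_integral_lborel_rotate[OF _ assms, of "indicator A"] by simp
  finally show "emeasure (distr lborel borel ((*) u)) A = emeasure lborel A" .
qed simp

text \<open>This replaces polar coordinates: the disc of radius \<open>sqrt a\<close> has area
  \<open>pi * a\<close>, linear in \<open>a\<close>, so the image measure has constant density on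
  the half-line. The sets \<open>{..a}\<close> determine it.\<close>

lemma distr_lborel_cmod_sq:
  "distr lborel borel (\<lambda>z::complex. (norm z)\<^sup>2) = density lborel (\<lambda>t::real. ennreal pi * indicator {0..} t)"
  (is "?M = ?N")
proof (rule measure_eqI_generator_eq[where \<Omega>=UNIV and E="range atMost" and A="\<lambda>n. {..real n}"])
  have M: "emeasure ?M {..a} = ennreal (pi * max 0 a)" for a
  proof (cases "a \<ge> 0")
    case True
    have "emeasure ?M {..a} = emeasure lborel (cball (0::complex) (sqrt a))"
      using True by (subst emeasure_distr)
        (auto intro!: arg_cong[where f="emeasure lborel"] simp: real_le_rsqrt real_sqrt_ge_abs1 sqrt_ge_absD real_le_lsqrt)
    then show ?thesis using True by (simp add: emeasure_cball unit_ball_vol_2)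
  next
    case False
    then have "\<not> (norm z)\<^sup>2 \<le> a" for z :: complex
      by (meson order_trans zero_le_power2)
    then have "(\<lambda>z::complex. (norm z)\<^sup>2) -` {..a} = {}" by blast
    with False show ?thesis by (subst emeasure_distr) auto
  qed
  have N: "emeasure ?N {..a} = ennreal (pi * max 0 a)" for a
  proof -
    have "emeasure ?N {..a} = (\<integral>\<^sup>+t. ennreal pi * indicator {0..a} t \<partial>lborel)"
      by (subst emeasure_density) (auto intro!: nn_integral_cong split: split_indicator)
    also have "\<dots> = ennreal pi * emeasure lborel {0..a}"
      by (simp add: nn_integral_cmult)
    also have "\<dots> = ennreal (pi * max 0 a)"
      by (simp add: emeasure_lborel_Icc_eq max_def ennreal_mult')
    finally show ?thesis .
  qed
  show "emeasure ?M X = emeasure ?N X" if "X \<in> range atMost" for X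
    using that M N by auto
  show "emeasure ?M {..real i} \<noteq> \<infinity>" for i by (simp add: M)
  show "(\<Union>i. {..real i}) = UNIV" by (auto intro: real_arch_simple)
qed (auto simp: Int_stable_def borel_eq_atMost)

lemma nn_integral_lborel_cmod_sq:
  fixes F :: "real \<Rightarrow> ennreal"
  assumes [measurable]: "F \<in> borel_measurable borel"
  shows "(\<integral>\<^sup>+z. F ((norm (z::complex))\<^sup>2) \<partial>lborel) = (\<integral>\<^sup>+t. ennreal pi * F t * indicator {0..} t \<partial>lborel)"
proof -
  have "(\<integral>\<^sup>+z. F ((norm (z::complex))\<^sup>2) \<partial>lborel) = (\<integral>\<^sup>+t. F t \<partial>distr lborel borel (\<lambda>z::complex. (norm z)\<^sup>2))"
    by (simp add: nn_integral_distr)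
  also have "\<dots> = (\<integral>\<^sup>+t. ennreal pi * indicator {0..} t * F t \<partial>lborel)"
    unfolding distr_lborel_cmod_sq by (simp add: nn_integral_density)
  finally show ?thesis by (simp add: mult_ac)
qed

text \<open>The factor \<open>\<alpha> / pi\<close> makes this a probability density, so that
  integrals against it are the Fock norm and inner product without further constants.\<close>

definition gauss :: "real \<Rightarrow> complex \<Rightarrow> real" where
  "gauss \<alpha> z = \<alpha> / pi * exp (- \<alpha> * (norm z)\<^sup>2)"

lemma gauss_measurable [measurable]: "gauss \<alpha> \<in> borel_measurable borel"
  unfolding gauss_def by measurable

lemma gauss_pos: "\<alpha> > 0 \<Longrightarrow> gauss \<alpha> z > 0"
  by (simp add: gauss_def)

lemma gauss_rotate: "norm u = 1 \<Longrightarrow> gauss \<alpha> (u * z) = gauss \<alpha> z"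
  by (simp add: gauss_def norm_mult)

text \<open>With \<open>t = norm z ^ 2\<close> the integrand becomes a multiple of an Erlang
  density, whose antiderivative is minus a Poisson distribution function. This is where Poisson
  probabilities enter.\<close>

lemma nn_integral_gauss_monomial_ball:
  assumes "\<alpha> > 0" "0 \<le> r"
  shows "(\<integral>\<^sup>+z\<in>ball 0 r. ennreal ((norm z) ^ (2 * k) * gauss \<alpha> z) \<partial>lborel)
    = ennreal (fact k / \<alpha> ^ k * (1 - poisson_cdf (Suc k) (\<alpha> * r\<^sup>2)))"
proof -
  define F where "F t = - (fact k / \<alpha> ^ k * poisson_cdf (Suc k) (\<alpha> * t))" for t
  define f where "f t = \<alpha> * (t ^ k * exp (- \<alpha> * t))" for t
  have F: "(F has_real_derivative f t) (at t)" for t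
  proof -
    have 1: "((\<lambda>t. poisson_cdf (Suc k) (\<alpha> * t)) has_real_derivative
        - ((\<alpha> * t) ^ k * exp (- (\<alpha> * t)) / fact k) * \<alpha>) (at t)"
      by (rule DERIV_chain2[OF DERIV_poisson_cdf]) (auto intro!: derivative_eq_intros)
    show ?thesis unfolding F_def f_def
      by (rule derivative_eq_intros 1 refl)+ (use assms in \<open>simp add: power_mult_distrib field_simps\<close>)
  qed
  have r: "norm z < r \<longleftrightarrow> (norm z)\<^sup>2 < r\<^sup>2" for z :: complex
    using assms abs_square_less_1 by (metis norm_ge_zero power_mono_iff zero_less_numeral linorder_not_le)
  have "(\<integral>\<^sup>+z\<in>ball 0 r. ennreal ((norm z) ^ (2 * k) * gauss \<alpha> z) \<partial>lborel)
    = (\<integral>\<^sup>+z. ennreal (f ((norm (z::complex))\<^sup>2) / pi) * indicator {..<r\<^sup>2} ((norm z)\<^sup>2) \<partial>lborel)"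
    by (intro nn_integral_cong)
       (use assms in \<open>auto simp: f_def gauss_def r mult_ac simp flip: power_mult split: split_indicator\<close>)
  also have "\<dots> = (\<integral>\<^sup>+t. ennreal pi * (ennreal (f t / pi) * indicator {..<r\<^sup>2} t) * indicator {0..} t \<partial>lborel)"
    by (rule nn_integral_lborel_cmod_sq) (simp add: f_def)
  also have "\<dots> = (\<integral>\<^sup>+t. ennreal (f t) * indicator {0..r\<^sup>2} t \<partial>lborel)"
  proof (rule nn_integral_cong_AE)
    show "AE t in lborel. ennreal pi * (ennreal (f t / pi) * indicator {..<r\<^sup>2} t) * indicator {0..} t
        = ennreal (f t) * indicator {0..r\<^sup>2} t"
      using AE_lborel_singleton[of "r\<^sup>2"]
      by eventually_elim (auto split: split_indicator simp flip: ennreal_mult')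
  qed
  also have "\<dots> = ennreal (F (r\<^sup>2) - F 0)"
    by (rule nn_integral_FTC_Icc[OF _ F]) (use assms in \<open>auto simp: f_def\<close>)
  also have "F (r\<^sup>2) - F 0 = fact k / \<alpha> ^ k * (1 - poisson_cdf (Suc k) (\<alpha> * r\<^sup>2))"
    by (simp add: F_def poisson_cdf_at_0 algebra_simps)
  finally show ?thesis .
qed

section \<open>Gaussian integrals of entire functions over discs\<close>

lemma ball_measurable [measurable]: "ball (a::'a::metric_space) r \<in> sets borel"
  by simp

text \<open>The cut-off to a disc makes the measure finite: continuous functions are integrable and
  Taylor series of entire functions can be integrated termwise, without any growth
  condition.\<close>

definition gauss_ball :: "real \<Rightarrow> real \<Rightarrow> complex measure" where
  "gauss_ball \<alpha> r = density lborel (\<lambda>z. ennreal (gauss \<alpha> z * indicator (ball 0 r) z))"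

lemma sets_gauss_ball [simp, measurable_cong]: "sets (gauss_ball \<alpha> r) = sets borel"
  and space_gauss_ball [simp]: "space (gauss_ball \<alpha> r) = UNIV"
  by (simp_all add: gauss_ball_def)

lemma nn_integral_gauss_ball:
  assumes "\<alpha> > 0" "h \<in> borel_measurable borel"
  shows "(\<integral>\<^sup>+z. h z \<partial>gauss_ball \<alpha> r) = (\<integral>\<^sup>+z\<in>ball 0 r. h z * ennreal (gauss \<alpha> z) \<partial>lborel)"
  unfolding gauss_ball_def using assms
  by (subst nn_integral_density) (auto intro!: nn_integral_cong split: split_indicator simp: mult.commute)

lemma nn_integral_gauss_ball_monomial:
  assumes "\<alpha> > 0" "0 \<le> r"
  shows "(\<integral>\<^sup>+z. ennreal ((norm z) ^ (2 * k)) \<partial>gauss_ball \<alpha> r)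
    = ennreal (fact k / \<alpha> ^ k * (1 - poisson_cdf (Suc k) (\<alpha> * r\<^sup>2)))"
proof -
  have "gauss \<alpha> z \<ge> 0" for z using gauss_pos[OF assms(1), of z] by simp
  then show ?thesis
    using assms by (simp add: nn_integral_gauss_ball nn_integral_gauss_monomial_ball flip: ennreal_mult')
qed

lemma finite_measure_gauss_ball:
  assumes "\<alpha> > 0" "0 \<le> r"
  shows "finite_measure (gauss_ball \<alpha> r)"
proof
  have "emeasure (gauss_ball \<alpha> r) (space (gauss_ball \<alpha> r)) = (\<integral>\<^sup>+z. 1 \<partial>gauss_ball \<alpha> r)" by simp
  also have "\<dots> \<noteq> \<infinity>" using nn_integral_gauss_ball_monomial[OF assms, of 0] by (simp add: power_0 ennreal_1)
  finally show "emeasure (gauss_ball \<alpha> r) (space (gauss_ball \<alpha> r)) \<noteq> \<infinity>" .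
qed

lemma AE_gauss_ball: "AE z in gauss_ball \<alpha> r. norm z < r"
  unfolding gauss_ball_def by (subst AE_density) (auto split: split_indicator)

lemma integral_gauss_ball_rotate:
  fixes h :: "complex \<Rightarrow> complex"
  assumes "\<alpha> > 0" "norm u = 1" and [measurable]: "h \<in> borel_measurable borel"
  shows "(LINT z|gauss_ball \<alpha> r. h (u * z)) = (LINT z|gauss_ball \<alpha> r. h z)"
proof -
  define w where "w z = gauss \<alpha> z * indicator (ball 0 r) z" for z :: complex
  have [measurable]: "w \<in> borel_measurable borel" unfolding w_def by measurable
  have w: "w (u * z) = w z" "0 \<le> w z" for z
    using gauss_pos[OF assms(1), of z] assms(2)
    by (auto simp: w_def gauss_rotate norm_mult split: split_indicator)
  have "(LINT z|gauss_ball \<alpha> r. h (u * z)) = (LINT z|lborel. w (u * z) *\<^sub>R h (u * z))"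
    unfolding gauss_ball_def w_def[symmetric] w(1) by (subst integral_density) (auto simp: w)
  also have "\<dots> = (LINT z|distr lborel borel ((*) u). w z *\<^sub>R h z)"
    by (subst integral_distr) auto
  also have "\<dots> = (LINT z|gauss_ball \<alpha> r. h z)"
    unfolding lborel_distr_rotate[OF assms(2)] gauss_ball_def w_def[symmetric]
    by (subst integral_density) (auto simp: w)
  finally show ?thesis .
qed

lemma integral_gauss_ball_monomials:
  assumes "\<alpha> > 0" "0 \<le> r"
  shows "(LINT z|gauss_ball \<alpha> r. z ^ j * cnj (z ^ k))
    = (if j = k then complex_of_real (fact k / \<alpha> ^ k * (1 - poisson_cdf (Suc k) (\<alpha> * r\<^sup>2))) else 0)"
proof (cases "j = k")
  case True
  have "z ^ k * cnj (z ^ k) = complex_of_real ((norm z) ^ (2 * k))" for z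
  proof -
    have "z ^ k * cnj (z ^ k) = complex_of_real ((norm (z ^ k))\<^sup>2)"
      by (rule complex_norm_square[symmetric])
    also have "(norm (z ^ k))\<^sup>2 = norm z ^ (2 * k)"
      by (simp add: norm_power power_mult[symmetric] mult.commute)
    finally show ?thesis .
  qed
  moreover have "(LINT z|gauss_ball \<alpha> r. (norm z) ^ (2 * k)) = fact k / \<alpha> ^ k * (1 - poisson_cdf (Suc k) (\<alpha> * r\<^sup>2))"
    using nn_integral_gauss_ball_monomial[OF assms, of k] poisson_cdf_le_1[of "\<alpha> * r\<^sup>2" "Suc k"] assms
    by (subst integral_eq_nn_integral) auto
  ultimately have "(LINT z|gauss_ball \<alpha> r. z ^ k * cnj (z ^ k))
      = complex_of_real (fact k / \<alpha> ^ k * (1 - poisson_cdf (Suc k) (\<alpha> * r\<^sup>2)))"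
    by (simp only: integral_complex_of_real)
  then show ?thesis using True by simp
next
  case False
  \<comment> \<open>Rotation by this \<open>u\<close> multiplies the integrand by
    \<open>u ^ j * cnj (u ^ k) = - 1\<close>, so the integral equals its own negative.\<close>
  define u where "u = cis (pi / (real j - real k))"
  let ?I = "LINT z|gauss_ball \<alpha> r. z ^ j * cnj (z ^ k)"
  have "u ^ j * cnj (u ^ k) = cis (real j * (pi / (real j - real k)) - real k * (pi / (real j - real k)))"
    unfolding u_def by (simp only: Complex.DeMoivre cis_cnj cis_mult diff_conv_add_uminus)
  also have "real j * (pi / (real j - real k)) - real k * (pi / (real j - real k)) = pi"
    using False by (simp flip: left_diff_distrib diff_divide_distrib)
  finally have u: "u ^ j * cnj (u ^ k) = - 1" by simp
  have "?I = (LINT z|gauss_ball \<alpha> r. (u * z) ^ j * cnj ((u * z) ^ k))"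
    by (rule integral_gauss_ball_rotate[symmetric, OF assms(1)])
       (simp add: u_def, intro borel_measurable_continuous_onI continuous_intros)
  also have "\<dots> = (LINT z|gauss_ball \<alpha> r. (u ^ j * cnj (u ^ k)) * (z ^ j * cnj (z ^ k)))"
    by (simp only: power_mult_distrib mult_ac complex_cnj_mult)
  also have "\<dots> = - ?I" unfolding u by simp
  finally show ?thesis using False by simp
qed

lemma integrable_gauss_ball:
  fixes h :: "complex \<Rightarrow> complex"
  assumes "\<alpha> > 0" "0 \<le> r" "continuous_on UNIV h"
  shows "integrable (gauss_ball \<alpha> r) h"
proof -
  interpret finite_measure "gauss_ball \<alpha> r" by (rule finite_measure_gauss_ball[OF assms(1,2)])
  have "compact (h ` cball 0 r)"
    by (intro compact_continuous_image continuous_on_subset[OF assms(3)]) auto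
  then have "bounded (h ` cball 0 r)" by (rule compact_imp_bounded)
  then obtain B where B: "\<forall>x\<in>h ` cball 0 r. norm x \<le> B"
    unfolding bounded_iff by blast
  show ?thesis
  proof (rule integrable_const_bound[where B=B])
    show "AE z in gauss_ball \<alpha> r. norm (h z) \<le> B"
      using AE_gauss_ball by (rule eventually_mono) (simp add: B)
  qed (use borel_measurable_continuous_onI[OF assms(3)] in simp)
qed

lemma taylor_sums:
  assumes "f holomorphic_on UNIV"
  shows "(\<lambda>k. (deriv ^^ k) f 0 / fact k * z ^ k) sums f z"
  using holomorphic_power_series[of f 0 "norm z + 1" z] holomorphic_on_subset[OF assms] by simp

text \<open>Dominated convergence applies because on the disc the partial sums are bounded by the
  absolutely convergent series at radius \<open>r\<close>. The factor \<open>h\<close> is general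
  since it will be a conjugated monomial in one use and the conjugate of \<open>g\<close> in
  another.\<close>

lemma integral_gauss_ball_sums:
  fixes h :: "complex \<Rightarrow> complex"
  assumes "\<alpha> > 0" "0 \<le> r" "g holomorphic_on UNIV" "continuous_on UNIV h"
  shows "(\<lambda>k. (deriv ^^ k) g 0 / fact k * (LINT z|gauss_ball \<alpha> r. z ^ k * h z))
           sums (LINT z|gauss_ball \<alpha> r. g z * h z)"
proof -
  define b where "b k = (deriv ^^ k) g 0 / fact k" for k
  have sums: "(\<lambda>k. b k * z ^ k) sums g z" for z
    unfolding b_def by (rule taylor_sums[OF assms(3)])
  have int: "integrable (gauss_ball \<alpha> r) (\<lambda>z. z ^ k * h z)" for k
    by (intro integrable_gauss_ball continuous_intros assms)
  have hn: "integrable (gauss_ball \<alpha> r) h" by (intro integrable_gauss_ball assms)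
  have [measurable]: "h \<in> borel_measurable borel" "g \<in> borel_measurable borel"
    using assms(3,4) by (auto intro!: borel_measurable_continuous_onI holomorphic_on_imp_continuous_on)
  \<comment> \<open>Convergence at the larger radius \<open>r + 1\<close> yields absolute
    convergence at \<open>r\<close>.\<close>
  have bs: "summable (\<lambda>k. norm (b k * complex_of_real r ^ k))"
    by (rule powser_insidea[of b "complex_of_real (r + 1)"]) (use sums sums_summable assms in blast, use assms in simp)
  define B where "B = (\<Sum>k. norm (b k * complex_of_real r ^ k))"
  have "(\<lambda>n. LINT z|gauss_ball \<alpha> r. (\<Sum>k<n. b k * (z ^ k * h z))) \<longlonglongrightarrow> (LINT z|gauss_ball \<alpha> r. g z * h z)"
  proof (rule integral_dominated_convergence[where w="\<lambda>z. B * norm (h z)"])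
    show "AE z in gauss_ball \<alpha> r. (\<lambda>n. \<Sum>k<n. b k * (z ^ k * h z)) \<longlonglongrightarrow> g z * h z"
    proof (rule AE_I2)
      fix z
      have "(\<lambda>n. (\<Sum>k<n. b k * z ^ k) * h z) \<longlonglongrightarrow> g z * h z"
        using sums[of z] unfolding sums_def by (rule tendsto_mult_right)
      then show "(\<lambda>n. \<Sum>k<n. b k * (z ^ k * h z)) \<longlonglongrightarrow> g z * h z"
        by (simp add: sum_distrib_right mult.assoc)
    qed
    show "AE z in gauss_ball \<alpha> r. norm (\<Sum>k<n. b k * (z ^ k * h z)) \<le> B * norm (h z)" for n
      using AE_gauss_ball
    proof eventually_elim
      case (elim z)
      have "norm (\<Sum>k<n. b k * z ^ k) \<le> (\<Sum>k<n. norm (b k * complex_of_real r ^ k))"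
        using elim by (intro sum_norm_le) (auto simp: norm_mult norm_power intro!: mult_left_mono power_mono)
      also have "\<dots> \<le> B" unfolding B_def by (intro sum_le_suminf bs) auto
      finally have "norm (\<Sum>k<n. b k * z ^ k) * norm (h z) \<le> B * norm (h z)" by (rule mult_right_mono) simp
      then show ?case by (simp add: sum_distrib_right mult.assoc flip: norm_mult)
    qed
    show "integrable (gauss_ball \<alpha> r) (\<lambda>z. B * norm (h z))" using hn by simp
  qed measurable
  moreover have "(LINT z|gauss_ball \<alpha> r. (\<Sum>k<n. b k * (z ^ k * h z)))
      = (\<Sum>k<n. b k * (LINT z|gauss_ball \<alpha> r. z ^ k * h z))" for n
    using int by (subst Bochner_Integration.integral_sum) auto
  ultimately show ?thesis by (simp add: sums_def b_def)
qed

lemma integral_gauss_ball_coeff: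
  assumes "\<alpha> > 0" "0 \<le> r" "g holomorphic_on UNIV"
  shows "(LINT z|gauss_ball \<alpha> r. g z * cnj (z ^ k))
    = (deriv ^^ k) g 0 * complex_of_real ((1 - poisson_cdf (Suc k) (\<alpha> * r\<^sup>2)) / \<alpha> ^ k)" (is "_ = ?R")
proof -
  have "(\<lambda>j. (deriv ^^ j) g 0 / fact j * (LINT z|gauss_ball \<alpha> r. z ^ j * cnj (z ^ k)))
           sums (LINT z|gauss_ball \<alpha> r. g z * cnj (z ^ k))"
    by (intro integral_gauss_ball_sums assms continuous_intros)
  moreover have "(\<lambda>j. (deriv ^^ j) g 0 / fact j * (LINT z|gauss_ball \<alpha> r. z ^ j * cnj (z ^ k))) sums ?R"
  proof -
    have "(\<lambda>j. (deriv ^^ j) g 0 / fact j * (LINT z|gauss_ball \<alpha> r. z ^ j * cnj (z ^ k)))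
        = (\<lambda>j. if j = k then ?R else 0)"
      unfolding integral_gauss_ball_monomials[OF assms(1,2)] by (auto simp: fun_eq_iff)
    then show ?thesis using sums_single[of k "\<lambda>_. ?R"] by simp
  qed
  ultimately show ?thesis by (rule sums_unique2)
qed

text \<open>Parseval on a disc: monomials are orthogonal on every disc around 0, not only on the
  whole plane, so the local mass is diagonal in the Taylor coefficients.\<close>

lemma integral_gauss_ball_norm_sums:
  assumes "\<alpha> > 0" "0 \<le> r" "g holomorphic_on UNIV"
  shows "(\<lambda>k. (norm ((deriv ^^ k) g 0))\<^sup>2 / (fact k * \<alpha> ^ k) * (1 - poisson_cdf (Suc k) (\<alpha> * r\<^sup>2)))
           sums (LINT z|gauss_ball \<alpha> r. (norm (g z))\<^sup>2)"
proof -
  have c: "continuous_on UNIV g" using assms by (simp add: holomorphic_on_imp_continuous_on)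
  have "(\<lambda>k. (deriv ^^ k) g 0 / fact k * (LINT z|gauss_ball \<alpha> r. z ^ k * cnj (g z)))
           sums (LINT z|gauss_ball \<alpha> r. g z * cnj (g z))"
    by (intro integral_gauss_ball_sums assms continuous_intros c)
  moreover have "(deriv ^^ k) g 0 / fact k * (LINT z|gauss_ball \<alpha> r. z ^ k * cnj (g z))
     = complex_of_real ((norm ((deriv ^^ k) g 0))\<^sup>2 / (fact k * \<alpha> ^ k) * (1 - poisson_cdf (Suc k) (\<alpha> * r\<^sup>2)))" for k
  proof -
    have "(LINT z|gauss_ball \<alpha> r. z ^ k * cnj (g z)) = cnj (LINT z|gauss_ball \<alpha> r. g z * cnj (z ^ k))"
    proof -
      have "z ^ k * cnj (g z) = cnj (g z * cnj (z ^ k))" for z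
        by (simp only: complex_cnj_mult complex_cnj_cnj mult.commute)
      then show ?thesis by (simp only: Bochner_Integration.integral_cnj)
    qed
    moreover have "c / fact k * cnj (c * complex_of_real (y / \<alpha> ^ k))
        = complex_of_real ((norm c)\<^sup>2 / (fact k * \<alpha> ^ k) * y)" for c y
      unfolding of_real_mult of_real_divide complex_norm_square by simp
    ultimately show ?thesis
      unfolding integral_gauss_ball_coeff[OF assms] by (simp only:)
  qed
  moreover have "(LINT z|gauss_ball \<alpha> r. g z * cnj (g z)) = complex_of_real (LINT z|gauss_ball \<alpha> r. (norm (g z))\<^sup>2)"
    by (simp only: complex_norm_square[symmetric] integral_complex_of_real)
  ultimately show ?thesis by (simp only: sums_of_real_iff)
qed

section \<open>Local masses and coefficients\<close>

lemma borel_measurable_cnj [measurable (raw)]: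
  "f \<in> borel_measurable M \<Longrightarrow> (\<lambda>x. cnj (f x)) \<in> borel_measurable M"
  by (rule measurable_compose[of f M borel cnj])
     (auto intro!: borel_measurable_continuous_onI continuous_intros)

text \<open>As a measure, it lets overlap, complements and exhaustion by discs be handled by measure
  theory, also while the norm of \<open>f\<close> is not yet known to be finite.\<close>

definition fock_measure :: "real \<Rightarrow> (complex \<Rightarrow> complex) \<Rightarrow> complex measure" where
  "fock_measure \<alpha> f = density lborel (\<lambda>z. ennreal ((norm (f z))\<^sup>2 * gauss \<alpha> z))"

text \<open>The coefficient of \<open>f\<close> at the \<open>k\<close>-th translated monomial;
  translation by \<open>- l\<close> moves \<open>l\<close> to 0. Written with derivatives it makes
  sense for every entire function and passes to locally uniform limits;
  \<open>fock_inner_translation_basis\<close> identifies it with the inner product.\<close>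

definition fock_coeff :: "real \<Rightarrow> complex \<Rightarrow> nat \<Rightarrow> (complex \<Rightarrow> complex) \<Rightarrow> complex" where
  "fock_coeff \<alpha> l k f
     = (deriv ^^ k) (fock_translation \<alpha> (- l) f) 0 / complex_of_real (sqrt (fact k * \<alpha> ^ k))"

lemma sets_fock_measure [simp, measurable_cong]: "sets (fock_measure \<alpha> f) = sets borel"
  and space_fock_measure [simp]: "space (fock_measure \<alpha> f) = UNIV"
  by (simp_all add: fock_measure_def)

lemma holomorphic_fock_translation:
  assumes "f holomorphic_on UNIV"
  shows "fock_translation \<alpha> l f holomorphic_on UNIV"
proof -
  have "(f \<circ> (\<lambda>z. z - l)) holomorphic_on UNIV"
    by (rule holomorphic_on_compose_gen[OF _ assms]) (auto intro!: holomorphic_intros)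
  then show ?thesis
    unfolding fock_translation_def o_def by (intro holomorphic_intros)
qed

lemma norm_diff_sq: "(norm (z - l))\<^sup>2 = (norm z)\<^sup>2 + (norm l)\<^sup>2 - 2 * Re (cnj l * z)" for z l :: complex
  unfolding cmod_power2 by (simp add: power2_eq_square algebra_simps)

text \<open>Completing the square: the exponential factor of the translation is exactly what carries
  the Gaussian weight along.\<close>

lemma norm_fock_translation:
  "(norm (fock_translation \<alpha> l f z))\<^sup>2 * gauss \<alpha> z = (norm (f (z - l)))\<^sup>2 * gauss \<alpha> (z - l)"
proof -
  have "(norm (exp (complex_of_real \<alpha> * cnj l * z - complex_of_real (\<alpha> / 2 * (norm l)\<^sup>2))))\<^sup>2 * gauss \<alpha> z
      = gauss \<alpha> (z - l)"
  proof -
    have "Re (complex_of_real \<alpha> * cnj l * z - complex_of_real (\<alpha> / 2 * (norm l)\<^sup>2))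
        = \<alpha> * Re (cnj l * z) - \<alpha> / 2 * (norm l)\<^sup>2"
      by (simp add: algebra_simps)
    then show ?thesis
      unfolding gauss_def norm_exp_eq_Re exp_double[symmetric] norm_diff_sq
      by (simp add: algebra_simps flip: exp_add)
  qed
  then show ?thesis
    unfolding fock_translation_def norm_mult power_mult_distrib by (metis mult.assoc mult.commute)
qed

lemma holomorphic_measurable: "f holomorphic_on UNIV \<Longrightarrow> f \<in> borel_measurable borel"
  by (intro borel_measurable_continuous_onI holomorphic_on_imp_continuous_on)

lemma emeasure_UNIV_le_of_balls:
  fixes M :: "complex measure"
  assumes "sets M = sets borel" "\<And>n. emeasure M (ball 0 (real n)) \<le> B"
  shows "emeasure M UNIV \<le> B"
proof -
  have "(SUP n. emeasure M (ball 0 (real n))) = emeasure M (\<Union>n. ball 0 (real n))"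
    by (rule SUP_emeasure_incseq) (auto simp: assms incseq_def)
  moreover have "(\<Union>n. ball (0::complex) (real n)) = UNIV"
    by (auto intro: reals_Archimedean2)
  ultimately show ?thesis using assms(2) by (metis SUP_least)
qed

context
  fixes \<alpha> :: real
  assumes \<alpha>: "\<alpha> > 0"
begin

lemma gauss_nonneg [simp]: "0 \<le> gauss \<alpha> z"
  using gauss_pos[OF \<alpha>, of z] by simp

lemma emeasure_fock_measure:
  assumes "f holomorphic_on UNIV" "A \<in> sets borel"
  shows "emeasure (fock_measure \<alpha> f) A = (\<integral>\<^sup>+z\<in>A. ennreal ((norm (f z))\<^sup>2 * gauss \<alpha> z) \<partial>lborel)"
  using assms holomorphic_measurable[OF assms(1)] unfolding fock_measure_def
  by (subst emeasure_density) auto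

lemma emeasure_fock_translation:
  assumes "f holomorphic_on UNIV" and [measurable]: "A \<in> sets borel"
  shows "emeasure (fock_measure \<alpha> (fock_translation \<alpha> l f)) A = emeasure (fock_measure \<alpha> f) ((+) l -` A)"
proof -
  note [measurable] = holomorphic_measurable[OF assms(1)]
  have [measurable]: "(+) l -` A \<in> sets borel"
    using measurable_sets[of "(+) l" borel borel A] by simp
  have "emeasure (fock_measure \<alpha> (fock_translation \<alpha> l f)) A
      = (\<integral>\<^sup>+z. ennreal ((norm (f (z - l)))\<^sup>2 * gauss \<alpha> (z - l)) * indicator A z \<partial>lborel)"
    by (simp add: emeasure_fock_measure holomorphic_fock_translation assms norm_fock_translation)
  also have "\<dots> = (\<integral>\<^sup>+z. ennreal ((norm (f z))\<^sup>2 * gauss \<alpha> z) * indicator A (l + z) \<partial>lborel)"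
    by (subst nn_integral_lborel_shift[symmetric, of _ l]) simp_all
  also have "\<dots> = emeasure (fock_measure \<alpha> f) ((+) l -` A)"
    by (subst emeasure_fock_measure) (auto simp: assms indicator_def intro!: nn_integral_cong)
  finally show ?thesis .
qed

lemma emeasure_fock_ball_0:
  assumes "f holomorphic_on UNIV" "0 \<le> r"
  shows "emeasure (fock_measure \<alpha> f) (ball 0 r) = ennreal (LINT z|gauss_ball \<alpha> r. (norm (f z))\<^sup>2)"
proof -
  note [measurable] = holomorphic_measurable[OF assms(1)]
  have "integrable (gauss_ball \<alpha> r) (\<lambda>z. complex_of_real ((norm (f z))\<^sup>2))"
    by (intro integrable_gauss_ball continuous_intros holomorphic_on_imp_continuous_on assms \<alpha>)
  then have "integrable (gauss_ball \<alpha> r) (\<lambda>z. (norm (f z))\<^sup>2)"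
    by (subst (asm) complex_of_real_integrable_eq)
  then have "ennreal (LINT z|gauss_ball \<alpha> r. (norm (f z))\<^sup>2) = (\<integral>\<^sup>+z. ennreal ((norm (f z))\<^sup>2) \<partial>gauss_ball \<alpha> r)"
    by (intro nn_integral_eq_integral[symmetric]) auto
  also have "\<dots> = emeasure (fock_measure \<alpha> f) (ball 0 r)"
    by (simp add: nn_integral_gauss_ball emeasure_fock_measure assms \<alpha> ennreal_mult'')
  finally show ?thesis ..
qed

lemma emeasure_fock_ball:
  assumes "f holomorphic_on UNIV"
  shows "emeasure (fock_measure \<alpha> f) (ball l r) = emeasure (fock_measure \<alpha> (fock_translation \<alpha> (- l) f)) (ball 0 r)"
  by (subst emeasure_fock_translation)
     (auto simp: assms dist_norm norm_minus_commute intro!: arg_cong[where f="emeasure _"])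

lemma emeasure_fock_ball_finite:
  assumes "f holomorphic_on UNIV"
  shows "emeasure (fock_measure \<alpha> f) (ball l r) = ennreal (measure (fock_measure \<alpha> f) (ball l r))"
proof (cases "0 \<le> r")
  case True
  have "emeasure (fock_measure \<alpha> f) (ball l r) < \<infinity>"
    unfolding emeasure_fock_ball[OF assms]
    by (subst emeasure_fock_ball_0[OF holomorphic_fock_translation[OF assms] True]) simp
  then show ?thesis by (intro emeasure_eq_ennreal_measure) auto
next
  case False
  then have "ball l r = {}" by simp
  then show ?thesis by (simp only: emeasure_empty measure_empty ennreal_0)
qed

text \<open>Translation moves the disc to the origin, where Parseval applies. Both local estimates
  and uniqueness on a disc are read off from this identity.\<close>

lemma fock_coeff_sums:
  assumes "f holomorphic_on UNIV" "0 \<le> r"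
  shows "(\<lambda>k. (norm (fock_coeff \<alpha> l k f))\<^sup>2 * (1 - poisson_cdf (Suc k) (\<alpha> * r\<^sup>2)))
           sums measure (fock_measure \<alpha> f) (ball l r)"
proof -
  note h = holomorphic_fock_translation[OF assms(1)]
  have "measure (fock_measure \<alpha> f) (ball l r)
      = (LINT z|gauss_ball \<alpha> r. (norm (fock_translation \<alpha> (- l) f z))\<^sup>2)"
    unfolding measure_def emeasure_fock_ball[OF assms(1)] emeasure_fock_ball_0[OF h assms(2)]
    by (simp add: enn2real_ennreal integral_nonneg_AE)
  moreover have "(norm (fock_coeff \<alpha> l k f))\<^sup>2
      = (norm ((deriv ^^ k) (fock_translation \<alpha> (- l) f) 0))\<^sup>2 / (fact k * \<alpha> ^ k)" for k
    using \<alpha> by (simp add: fock_coeff_def norm_divide power_divide)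
  ultimately show ?thesis
    using integral_gauss_ball_norm_sums[OF \<alpha> assms(2) h] by simp
qed

lemma mem_fock_iff:
  "f \<in> fock \<alpha> \<longleftrightarrow> f holomorphic_on UNIV \<and> emeasure (fock_measure \<alpha> f) UNIV < \<infinity>"
proof -
  have "integrable lborel (\<lambda>z. (norm (f z))\<^sup>2 * exp (- \<alpha> * (norm z)\<^sup>2))
      \<longleftrightarrow> emeasure (fock_measure \<alpha> f) UNIV < \<infinity>" if "f holomorphic_on UNIV"
  proof -
    note [measurable] = holomorphic_measurable[OF that]
    have "integrable lborel (\<lambda>z. (norm (f z))\<^sup>2 * exp (- \<alpha> * (norm z)\<^sup>2))
      \<longleftrightarrow> integrable lborel (\<lambda>z. \<alpha> / pi * ((norm (f z))\<^sup>2 * exp (- \<alpha> * (norm z)\<^sup>2)))"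
      using \<alpha> by (subst integrable_mult_left_iff) auto
    also have "\<dots> \<longleftrightarrow> integrable lborel (\<lambda>z. (norm (f z))\<^sup>2 * gauss \<alpha> z)"
      by (simp add: gauss_def mult_ac)
    also have "\<dots> \<longleftrightarrow> emeasure (fock_measure \<alpha> f) UNIV < \<infinity>"
      by (simp add: integrable_iff_bounded emeasure_fock_measure that abs_mult)
    finally show ?thesis .
  qed
  then show ?thesis by (auto simp: fock_def)
qed

lemma fock_holomorphic: "f \<in> fock \<alpha> \<Longrightarrow> f holomorphic_on UNIV"
  by (simp add: fock_def)

lemma integrable_fock:
  assumes "f \<in> fock \<alpha>"
  shows "integrable lborel (\<lambda>z. (norm (f z))\<^sup>2 * gauss \<alpha> z)"
proof -
  note h = fock_holomorphic[OF assms]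
  note [measurable] = holomorphic_measurable[OF h]
  show ?thesis
    using assms unfolding mem_fock_iff by (simp add: integrable_iff_bounded emeasure_fock_measure[OF h] abs_mult)
qed

lemma emeasure_fock_UNIV:
  assumes "f \<in> fock \<alpha>"
  shows "emeasure (fock_measure \<alpha> f) UNIV = ennreal (fock_norm2 \<alpha> f)"
proof -
  have "emeasure (fock_measure \<alpha> f) UNIV = (\<integral>\<^sup>+z. ennreal ((norm (f z))\<^sup>2 * gauss \<alpha> z) \<partial>lborel)"
    by (simp add: emeasure_fock_measure fock_holomorphic[OF assms])
  also have "\<dots> = ennreal (LINT z|lborel. (norm (f z))\<^sup>2 * gauss \<alpha> z)"
    by (intro nn_integral_eq_integral integrable_fock assms) simp
  also have "(LINT z|lborel. (norm (f z))\<^sup>2 * gauss \<alpha> z)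
      = (LINT z|lborel. \<alpha> / pi * ((norm (f z))\<^sup>2 * exp (- \<alpha> * (norm z)\<^sup>2)))"
    by (simp add: gauss_def mult_ac)
  also have "\<dots> = fock_norm2 \<alpha> f"
    unfolding fock_norm2_def by (rule integral_mult_right_zero)
  finally show ?thesis .
qed

lemma fock_norm2_nonneg: "0 \<le> fock_norm2 \<alpha> f"
  using \<alpha> by (simp add: fock_norm2_def)

lemma monomial_mem_fock: "(\<lambda>z. z ^ k) \<in> fock \<alpha>"
proof -
  have h: "(\<lambda>z::complex. z ^ k) holomorphic_on UNIV" by (intro holomorphic_intros)
  have "emeasure (fock_measure \<alpha> (\<lambda>z. z ^ k)) UNIV \<le> ennreal (fact k / \<alpha> ^ k)"
  proof (rule emeasure_UNIV_le_of_balls)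
    fix n
    have "emeasure (fock_measure \<alpha> (\<lambda>z. z ^ k)) (ball 0 (real n))
        = ennreal (fact k / \<alpha> ^ k * (1 - poisson_cdf (Suc k) (\<alpha> * (real n)\<^sup>2)))"
      by (simp add: emeasure_fock_measure[OF h] norm_power power_mult[symmetric] mult.commute[of _ 2]
          nn_integral_gauss_monomial_ball[OF \<alpha>])
    also have "\<dots> \<le> ennreal (fact k / \<alpha> ^ k)"
      using \<alpha> poisson_cdf_nonneg[of "\<alpha> * (real n)\<^sup>2" "Suc k"]
      by (intro ennreal_leI mult_left_le) auto
    finally show "emeasure (fock_measure \<alpha> (\<lambda>z. z ^ k)) (ball 0 (real n)) \<le> ennreal (fact k / \<alpha> ^ k)" .
  qed simp
  with h show ?thesis by (auto simp: mem_fock_iff intro: le_less_trans)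
qed

lemma fock_translation_mem_fock: "f \<in> fock \<alpha> \<Longrightarrow> fock_translation \<alpha> l f \<in> fock \<alpha>"
  by (auto simp: mem_fock_iff holomorphic_fock_translation emeasure_fock_translation)

text \<open>The formula on discs carries a Poisson tail as factor, which tends to 1 as the radius
  grows. Since \<open>g\<close> and the monomial both lie in the space,
  \<open>a * b <= a^2 + b^2\<close> gives an integrable majorant.\<close>

lemma integral_monomial_fock:
  assumes "g \<in> fock \<alpha>"
  shows "(LINT z|lborel. g z * cnj (z ^ k) * complex_of_real (gauss \<alpha> z)) = (deriv ^^ k) g 0 / complex_of_real (\<alpha> ^ k)"
proof -
  let ?F = "\<lambda>z. g z * cnj (z ^ k)"
  note gh = fock_holomorphic[OF assms]
  note [measurable] = holomorphic_measurable[OF gh]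
  have "(\<lambda>n. LINT z|lborel. (gauss \<alpha> z * indicator (ball 0 (real n)) z) *\<^sub>R ?F z)
      \<longlonglongrightarrow> (LINT z|lborel. gauss \<alpha> z *\<^sub>R ?F z)"
  proof (rule integral_dominated_convergence[where
        w="\<lambda>z. (norm (g z))\<^sup>2 * gauss \<alpha> z + (norm (z ^ k))\<^sup>2 * gauss \<alpha> z"])
    show "integrable lborel (\<lambda>z. (norm (g z))\<^sup>2 * gauss \<alpha> z + (norm (z ^ k))\<^sup>2 * gauss \<alpha> z)"
      by (intro Bochner_Integration.integrable_add integrable_fock assms monomial_mem_fock)
    show "AE z in lborel. (\<lambda>n. (gauss \<alpha> z * indicator (ball 0 (real n)) z) *\<^sub>R ?F z) \<longlonglongrightarrow> gauss \<alpha> z *\<^sub>R ?F z"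
    proof (rule AE_I2)
      fix z :: complex
      obtain N where "norm z < real N" using reals_Archimedean2 by blast
      then have "\<forall>\<^sub>F n in sequentially. (gauss \<alpha> z * indicator (ball 0 (real n)) z) *\<^sub>R ?F z = gauss \<alpha> z *\<^sub>R ?F z"
        by (intro eventually_sequentiallyI[of N]) (auto simp: indicator_def)
      then show "(\<lambda>n. (gauss \<alpha> z * indicator (ball 0 (real n)) z) *\<^sub>R ?F z) \<longlonglongrightarrow> gauss \<alpha> z *\<^sub>R ?F z"
        by (rule tendsto_eventually)
    qed
    show "AE z in lborel. norm ((gauss \<alpha> z * indicator (ball 0 (real n)) z) *\<^sub>R ?F z)
        \<le> (norm (g z))\<^sup>2 * gauss \<alpha> z + (norm (z ^ k))\<^sup>2 * gauss \<alpha> z" for n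
    proof (rule AE_I2)
      fix z :: complex
      have ab: "a * b \<le> a\<^sup>2 + b\<^sup>2" if "0 \<le> a" "0 \<le> b" for a b :: real
        using sum_squares_bound[of a b] that zero_le_power2[of a] zero_le_power2[of b]
          mult_nonneg_nonneg[OF that] by linarith
      have "norm ((gauss \<alpha> z * indicator (ball 0 (real n)) z) *\<^sub>R ?F z) \<le> (norm (g z) * norm (z ^ k)) * gauss \<alpha> z"
        by (auto simp: norm_mult abs_mult indicator_def norm_power mult_ac)
      also have "\<dots> \<le> ((norm (g z))\<^sup>2 + (norm (z ^ k))\<^sup>2) * gauss \<alpha> z"
        by (intro mult_right_mono ab) auto
      finally show "norm ((gauss \<alpha> z * indicator (ball 0 (real n)) z) *\<^sub>R ?F z)
        \<le> (norm (g z))\<^sup>2 * gauss \<alpha> z + (norm (z ^ k))\<^sup>2 * gauss \<alpha> z"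
        by (simp add: distrib_right)
    qed
  qed measurable
  moreover have "(LINT z|lborel. (gauss \<alpha> z * indicator (ball 0 (real n)) z) *\<^sub>R ?F z)
     = (deriv ^^ k) g 0 * complex_of_real ((1 - poisson_cdf (Suc k) (\<alpha> * (real n)\<^sup>2)) / \<alpha> ^ k)" for n
    unfolding integral_gauss_ball_coeff[OF \<alpha> of_nat_0_le_iff gh, symmetric] gauss_ball_def
    by (rule integral_density[symmetric]) auto
  moreover have "(\<lambda>n. (deriv ^^ k) g 0 * complex_of_real ((1 - poisson_cdf (Suc k) (\<alpha> * (real n)\<^sup>2)) / \<alpha> ^ k))
     \<longlonglongrightarrow> (deriv ^^ k) g 0 * complex_of_real ((1 - 0) / \<alpha> ^ k)"
  proof (intro tendsto_intros)
    show "(\<lambda>n. poisson_cdf (Suc k) (\<alpha> * (real n)\<^sup>2)) \<longlonglongrightarrow> 0"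
    proof (rule filterlim_compose[OF tendsto_poisson_cdf])
      have "filterlim (\<lambda>n. (real n)\<^sup>2) at_top sequentially"
        by (intro filterlim_pow_at_top filterlim_real_sequentially) simp
      then show "filterlim (\<lambda>n. \<alpha> * (real n)\<^sup>2) at_top sequentially"
        using \<alpha> by (intro filterlim_tendsto_pos_mult_at_top[OF tendsto_const])
    qed
  qed (use \<alpha> in auto)
  ultimately have "(LINT z|lborel. gauss \<alpha> z *\<^sub>R ?F z) = (deriv ^^ k) g 0 * complex_of_real ((1 - 0) / \<alpha> ^ k)"
    by (simp only: LIMSEQ_unique)
  then show ?thesis by (simp add: scaleR_conv_of_real mult_ac)
qed

text \<open>Translation is unitary: substituting \<open>l + x\<close> turns the pairing with a
  translated monomial into the pairing of \<open>fock_translation \<alpha> (- l) f\<close> with the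
  monomial itself, which is a Taylor coefficient. The fact \<open>F\<close> is this identity for the
  integrands.\<close>

lemma fock_inner_translation_basis:
  assumes "f \<in> fock \<alpha>"
  shows "fock_inner \<alpha> f (fock_translation \<alpha> l (fock_basis \<alpha> k)) = fock_coeff \<alpha> l k f"
proof -
  define g where "g = fock_translation \<alpha> (- l) f"
  define c where "c = sqrt (\<alpha> ^ k / fact k)"
  define F where "F z = f z * cnj (fock_translation \<alpha> l (fock_basis \<alpha> k) z) * complex_of_real (gauss \<alpha> z)" for z
  have g: "g \<in> fock \<alpha>" unfolding g_def by (rule fock_translation_mem_fock[OF assms])
  have F: "F (l + x) = complex_of_real c * (g x * cnj (x ^ k) * complex_of_real (gauss \<alpha> x))" for x
  proof -
    define a where "a = complex_of_real \<alpha>"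
    define u where "u = a * cnj l * (l + x) - a / 2 * (l * cnj l)"
    define v where "v = a * cnj (- l) * x - a / 2 * (l * cnj l)"
    define b where "b = complex_of_real (\<alpha> / pi)"
    have nn: "complex_of_real (s * (norm y)\<^sup>2) = complex_of_real s * (y * cnj y)" for s y
      unfolding of_real_mult complex_norm_square ..
    have a2: "complex_of_real (\<alpha> / 2) = a / 2" "complex_of_real (- \<alpha>) = - a" by (simp_all add: a_def)
    have e: "exp (cnj u) * exp (- a * ((l + x) * cnj (l + x))) = exp v * exp (- a * (x * cnj x))"
      by (simp add: a_def u_def v_def algebra_simps flip: exp_add)
    have t1: "fock_translation \<alpha> l (fock_basis \<alpha> k) (l + x) = exp u * (complex_of_real c * x ^ k)"
      unfolding fock_translation_def fock_basis_def c_def[symmetric] nn a2 u_def a_def[symmetric] by simp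
    have t2: "g x = exp v * f (l + x)"
      unfolding g_def fock_translation_def norm_minus_cancel nn a2 v_def a_def[symmetric]
      by (simp add: add.commute)
    have t3: "complex_of_real (gauss \<alpha> y) = b * exp (- a * (y * cnj y))" for y
      unfolding gauss_def of_real_mult[of "\<alpha> / pi"] exp_of_real[symmetric] nn a2 b_def ..
    have "F (l + x) = (exp (cnj u) * exp (- a * ((l + x) * cnj (l + x))))
        * (f (l + x) * complex_of_real c * cnj (x ^ k) * b)"
      unfolding F_def t1 t3 by (simp add: exp_cnj)
    also have "\<dots> = complex_of_real c * (g x * cnj (x ^ k) * complex_of_real (gauss \<alpha> x))"
      unfolding e t2 t3 by simp
    finally show ?thesis .
  qed
  have "fock_basis \<alpha> k holomorphic_on UNIV"
    unfolding fock_basis_def[abs_def] by (intro holomorphic_intros)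
  note bh = holomorphic_measurable[OF holomorphic_fock_translation[OF this], of \<alpha> l]
  have Fm: "F \<in> borel_measurable borel"
    unfolding F_def using holomorphic_measurable[OF fock_holomorphic[OF assms]] bh
    by (auto intro!: borel_measurable_times borel_measurable_cnj)
  have "fock_inner \<alpha> f (fock_translation \<alpha> l (fock_basis \<alpha> k)) = (LINT z|lborel. F z)"
    unfolding fock_inner_def F_def gauss_def
    by (subst integral_mult_right_zero[symmetric]) (simp add: mult_ac)
  also have "\<dots> = (LINT z|distr lborel borel ((+) l). F z)" by (simp add: lborel_distr_plus)
  also have "\<dots> = (LINT x|lborel. F (l + x))" using Fm by (subst integral_distr) auto
  also have "\<dots> = complex_of_real c * ((deriv ^^ k) g 0 / complex_of_real (\<alpha> ^ k))"
    unfolding F by (subst integral_mult_right_zero) (simp only: integral_monomial_fock[OF g])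
  also have "\<dots> = (deriv ^^ k) g 0 * complex_of_real (c / \<alpha> ^ k)" by simp
  also have "c / \<alpha> ^ k = 1 / sqrt (fact k * \<alpha> ^ k)"
  proof -
    have "c * sqrt (fact k * \<alpha> ^ k) = sqrt ((\<alpha> ^ k)\<^sup>2)"
      unfolding c_def real_sqrt_mult[symmetric] by (simp add: power2_eq_square)
    then have "c * sqrt (fact k * \<alpha> ^ k) = \<alpha> ^ k" using \<alpha> by simp
    then show ?thesis using \<alpha> by (simp add: field_simps)
  qed
  finally show ?thesis by (simp add: fock_coeff_def g_def)
qed

lemma quotient_norm2_eq:
  "f \<in> fock \<alpha> \<Longrightarrow> quotient_norm2 \<alpha> l n f = (\<Sum>k<n. (norm (fock_coeff \<alpha> l k f))\<^sup>2)"
  by (simp add: quotient_norm2_def fock_inner_translation_basis)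

end

section \<open>Local estimates and necessity\<close>

lemma infsum_ennreal_le:
  fixes f :: "'a \<Rightarrow> ennreal"
  assumes "\<And>F. finite F \<Longrightarrow> F \<subseteq> A \<Longrightarrow> sum f F \<le> B"
  shows "infsum f A \<le> B"
  using assms by (subst nonneg_infsum_complete) (auto intro!: SUP_least)

lemma sum_le_infsum_ennreal:
  fixes f :: "'a \<Rightarrow> ennreal"
  assumes "finite F" "F \<subseteq> A"
  shows "sum f F \<le> infsum f A"
  using assms by (subst nonneg_infsum_complete) (auto intro!: SUP_upper)

text \<open>Countable subadditivity for unordered sums. Repetitions in the enumeration do no harm
  because only the images of initial segments are used.\<close>

lemma emeasure_UN_le_infsum:
  fixes B :: "'i \<Rightarrow> 'a set"
  assumes "countable I" "\<And>i. i \<in> I \<Longrightarrow> B i \<in> sets M"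
  shows "emeasure M (\<Union>i\<in>I. B i) \<le> (\<Sum>\<^sub>\<infinity>i\<in>I. emeasure M (B i))"
proof (cases "I = {}")
  case False
  define g where "g = from_nat_into I"
  have g: "range g = I" unfolding g_def by (rule range_from_nat_into[OF False assms(1)])
  have gI: "g k \<in> I" for k using g by blast
  have "emeasure M (\<Union>i\<in>I. B i) = emeasure M (\<Union>n. \<Union>i\<in>g ` {..<n}. B i)"
    using g by (intro arg_cong[where f="emeasure M"]) fastforce
  also have "\<dots> = (SUP n. emeasure M (\<Union>i\<in>g ` {..<n}. B i))"
    by (rule SUP_emeasure_incseq[symmetric])
       (use gI assms(2) in \<open>auto simp: incseq_def image_subset_iff intro!: sets.finite_UN\<close>, force)
  also have "\<dots> \<le> (\<Sum>\<^sub>\<infinity>i\<in>I. emeasure M (B i))"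
  proof (rule SUP_least)
    fix n
    have "emeasure M (\<Union>i\<in>g ` {..<n}. B i) \<le> (\<Sum>i\<in>g ` {..<n}. emeasure M (B i))"
      by (rule emeasure_subadditive_finite) (use gI assms(2) in auto)
    also have "\<dots> \<le> (\<Sum>\<^sub>\<infinity>i\<in>I. emeasure M (B i))"
      by (rule sum_le_infsum_ennreal) (use gI in auto)
    finally show "emeasure M (\<Union>i\<in>g ` {..<n}. B i) \<le> (\<Sum>\<^sub>\<infinity>i\<in>I. emeasure M (B i))" .
  qed
  finally show ?thesis .
qed simp

text \<open>The pointwise overlap bound is integrated against \<open>M\<close>. Each indicator
  vanishes off the union, so the union can be kept on the right-hand side.\<close>

lemma infsum_emeasure_le_overlap:
  assumes "sets M = sets borel"
  shows "(\<Sum>\<^sub>\<infinity>l\<in>\<Lambda>. emeasure M (ball l (sqrt (real (m l) / \<alpha>))))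
    \<le> overlap \<alpha> \<Lambda> m * emeasure M (\<Union>l\<in>\<Lambda>. ball l (sqrt (real (m l) / \<alpha>)))"
proof (rule infsum_ennreal_le)
  define D where "D l = ball l (sqrt (real (m l) / \<alpha>))" for l
  have D: "D l \<in> sets M" "(\<Union>l\<in>\<Lambda>. D l) \<in> sets M" for l
    unfolding assms by (auto simp: D_def intro!: borel_open)
  fix F assume F: "finite F" "F \<subseteq> \<Lambda>"
  have "(\<Sum>l\<in>F. emeasure M (D l)) = (\<integral>\<^sup>+z. (\<Sum>l\<in>F. indicator (D l) z) \<partial>M)"
    using D F by (subst nn_integral_sum) auto
  also have "\<dots> \<le> (\<integral>\<^sup>+z. overlap \<alpha> \<Lambda> m * indicator (\<Union>l\<in>\<Lambda>. D l) z \<partial>M)"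
  proof (rule nn_integral_mono)
    fix z
    show "(\<Sum>l\<in>F. indicator (D l) z) \<le> overlap \<alpha> \<Lambda> m * indicator (\<Union>l\<in>\<Lambda>. D l) z"
    proof (cases "z \<in> (\<Union>l\<in>\<Lambda>. D l)")
      case True
      have "(\<Sum>l\<in>F. indicator (D l) z) \<le> (\<Sum>\<^sub>\<infinity>l\<in>\<Lambda>. indicator (D l) z :: ennreal)"
        by (rule sum_le_infsum_ennreal[OF F])
      also have "\<dots> \<le> overlap \<alpha> \<Lambda> m" unfolding overlap_def D_def by (rule SUP_upper) simp
      finally show ?thesis using True by simp
    next
      case False
      then have "(\<Sum>l\<in>F. indicator (D l) z :: ennreal) = 0" using F by (intro sum.neutral) auto
      then show ?thesis by simp
    qed
  qed
  also have "\<dots> = overlap \<alpha> \<Lambda> m * emeasure M (\<Union>l\<in>\<Lambda>. D l)"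
    using D by (simp add: nn_integral_cmult_indicator)
  finally show "(\<Sum>l\<in>F. emeasure M (ball l (sqrt (real (m l) / \<alpha>))))
    \<le> overlap \<alpha> \<Lambda> m * emeasure M (\<Union>l\<in>\<Lambda>. ball l (sqrt (real (m l) / \<alpha>)))"
    unfolding D_def .
qed

lemma higher_deriv_exp_linear:
  "(deriv ^^ k) (\<lambda>z. A * exp (B * z)) = (\<lambda>z::complex. A * B ^ k * exp (B * z))"
proof (induction k)
  case (Suc k)
  have "deriv (\<lambda>z. A * B ^ k * exp (B * z)) z = A * B ^ Suc k * exp (B * z)" for z
    by (rule DERIV_imp_deriv) (auto intro!: derivative_eq_intros)
  then have "deriv (\<lambda>z. A * B ^ k * exp (B * z)) = (\<lambda>z. A * B ^ Suc k * exp (B * z))" by blast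
  then show ?case by (simp add: Suc.IH)
qed simp

context
  fixes \<alpha> :: real
  assumes \<alpha>: "\<alpha> > 0"
begin

lemma sum_fock_coeff_le_mass:
  assumes "f holomorphic_on UNIV" "1 \<le> m"
  shows "(\<Sum>k<m. (norm (fock_coeff \<alpha> l k f))\<^sup>2)
    \<le> 2 * measure (fock_measure \<alpha> f) (ball l (sqrt (real m / \<alpha>)))"
proof -
  have "(\<Sum>k<m. (norm (fock_coeff \<alpha> l k f))\<^sup>2 * (1 / 2))
      \<le> (\<Sum>k<m. (norm (fock_coeff \<alpha> l k f))\<^sup>2 * (1 - poisson_cdf (Suc k) (real m)))"
  proof (intro sum_mono mult_left_mono)
    fix k assume "k \<in> {..<m}"
    then have "poisson_cdf (Suc k) (real m) \<le> poisson_cdf m (real m)"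
      by (intro poisson_cdf_mono) auto
    then show "1 / 2 \<le> 1 - poisson_cdf (Suc k) (real m)"
      using poisson_cdf_le_half[OF assms(2)] by simp
  qed simp
  also have "\<dots> \<le> measure (fock_measure \<alpha> f) (ball l (sqrt (real m / \<alpha>)))"
  proof -
    have "(\<lambda>k. (norm (fock_coeff \<alpha> l k f))\<^sup>2 * (1 - poisson_cdf (Suc k) (real m)))
        sums measure (fock_measure \<alpha> f) (ball l (sqrt (real m / \<alpha>)))"
      using fock_coeff_sums[OF \<alpha> assms(1), of "sqrt (real m / \<alpha>)" l] \<alpha> by simp
    then show ?thesis
      using poisson_cdf_le_1[of "real m"] unfolding sums_iff
      by (metis (no_types, lifting) diff_ge_0_iff_ge finite_lessThan mult_nonneg_nonneg of_nat_0_le_iff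
          sum_le_suminf zero_le_power2)
  qed
  finally show ?thesis unfolding sum_distrib_right[symmetric] by simp
qed

text \<open>The series is split at \<open>n\<close>: below it the weights are at most 1, and from
  \<open>n\<close> on \<open>m <= Suc n <= Suc k\<close> permits the tail comparison. The value
  \<open>n = m - 1\<close> is allowed, so one coefficient may be missing.\<close>

lemma mass_shrunk_ball_le:
  assumes "f holomorphic_on UNIV" "0 < C" "C < sqrt (real m / \<alpha>)" "m \<le> Suc n"
  shows "measure (fock_measure \<alpha> f) (ball l (sqrt (real m / \<alpha>) - C))
    \<le> (\<Sum>k<n. (norm (fock_coeff \<alpha> l k f))\<^sup>2)
       + exp (- 2 * \<alpha> * C\<^sup>2) * measure (fock_measure \<alpha> f) (ball l (sqrt (real m / \<alpha>)))"
proof -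
  define a where "a k = (norm (fock_coeff \<alpha> l k f))\<^sup>2" for k
  define x where "x = \<alpha> * (sqrt (real m / \<alpha>) - C)\<^sup>2"
  define c where "c = sqrt \<alpha> * C"
  have c: "0 < c" "c < sqrt (real m)" "c\<^sup>2 = \<alpha> * C\<^sup>2"
    using assms \<alpha> by (auto simp: c_def real_sqrt_divide power_mult_distrib field_simps)
  have x: "x = (sqrt (real m) - c)\<^sup>2"
  proof -
    have "(sqrt (real m) - c)\<^sup>2 = (sqrt \<alpha> * (sqrt (real m / \<alpha>) - C))\<^sup>2"
      using \<alpha> by (simp add: c_def real_sqrt_divide right_diff_distrib)
    then show ?thesis using \<alpha> by (simp add: x_def power_mult_distrib)
  qed
  have s1: "(\<lambda>k. a k * (1 - poisson_cdf (Suc k) x))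
      sums measure (fock_measure \<alpha> f) (ball l (sqrt (real m / \<alpha>) - C))"
    unfolding a_def x_def by (rule fock_coeff_sums[OF \<alpha> assms(1)]) (use assms in simp)
  have "(\<lambda>k. a k * (1 - poisson_cdf (Suc k) (real m)))
      sums measure (fock_measure \<alpha> f) (ball l (sqrt (real m / \<alpha>)))"
    using fock_coeff_sums[OF \<alpha> assms(1), of "sqrt (real m / \<alpha>)" l] \<alpha> by (simp add: a_def)
  then have s2: "(\<lambda>k. (if k \<in> {..<n} then a k else 0) + exp (- 2 * \<alpha> * C\<^sup>2) * (a k * (1 - poisson_cdf (Suc k) (real m))))
      sums ((\<Sum>k<n. a k) + exp (- 2 * \<alpha> * C\<^sup>2) * measure (fock_measure \<alpha> f) (ball l (sqrt (real m / \<alpha>))))"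
    by (intro sums_add sums_mult sums_If_finite_set) auto
  have "a k * (1 - poisson_cdf (Suc k) x)
      \<le> (if k \<in> {..<n} then a k else 0) + exp (- 2 * \<alpha> * C\<^sup>2) * (a k * (1 - poisson_cdf (Suc k) (real m)))" for k
  proof (cases "k < n")
    case True
    have "a k * (1 - poisson_cdf (Suc k) x) \<le> a k"
      using poisson_cdf_nonneg[of x "Suc k"] \<alpha> by (intro mult_left_le) (auto simp: x_def a_def)
    moreover have "0 \<le> exp (- 2 * \<alpha> * C\<^sup>2) * (a k * (1 - poisson_cdf (Suc k) (real m)))"
      using poisson_cdf_le_1[of "real m" "Suc k"] by (simp add: a_def)
    ultimately show ?thesis using True by simp
  next
    case False
    then have "a k * (1 - poisson_cdf (Suc k) x)
        \<le> a k * (exp (- 2 * c\<^sup>2) * (1 - poisson_cdf (Suc k) (real m)))"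
      unfolding x using assms(4) c by (intro mult_left_mono poisson_tail_shrink) (auto simp: a_def)
    then show ?thesis using False c(3) by (simp add: mult_ac)
  qed
  then show ?thesis using sums_le[OF _ s1 s2] by (simp add: a_def)
qed

text \<open>It serves twice: in (b) as the upper sampling inequality, and in (a) for a kernel that
  has little mass on the union.\<close>

lemma infsum_quotient_norm2_le:
  assumes "f \<in> fock \<alpha>" "divisor \<Lambda> m"
  shows "(\<Sum>\<^sub>\<infinity>l\<in>\<Lambda>. ennreal (quotient_norm2 \<alpha> l (m l) f))
    \<le> 2 * (overlap \<alpha> \<Lambda> m * emeasure (fock_measure \<alpha> f) (\<Union>l\<in>\<Lambda>. ball l (sqrt (real (m l) / \<alpha>))))"
proof (rule infsum_ennreal_le)
  let ?D = "\<lambda>l. ball l (sqrt (real (m l) / \<alpha>))"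
  fix F assume F: "finite F" "F \<subseteq> \<Lambda>"
  note h = fock_holomorphic[OF \<alpha> assms(1)]
  have "(\<Sum>l\<in>F. ennreal (quotient_norm2 \<alpha> l (m l) f)) \<le> (\<Sum>l\<in>F. 2 * emeasure (fock_measure \<alpha> f) (?D l))"
  proof (rule sum_mono)
    fix l assume "l \<in> F"
    then have "1 \<le> m l" using F assms(2) by (auto simp: divisor_def)
    then have "ennreal (quotient_norm2 \<alpha> l (m l) f) \<le> ennreal (2 * measure (fock_measure \<alpha> f) (?D l))"
      unfolding quotient_norm2_eq[OF \<alpha> assms(1)] by (intro ennreal_leI sum_fock_coeff_le_mass h)
    also have "\<dots> = 2 * emeasure (fock_measure \<alpha> f) (?D l)"
      unfolding emeasure_fock_ball_finite[OF \<alpha> h] by (simp add: ennreal_mult')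
    finally show "ennreal (quotient_norm2 \<alpha> l (m l) f) \<le> 2 * emeasure (fock_measure \<alpha> f) (?D l)" .
  qed
  also have "\<dots> = 2 * (\<Sum>l\<in>F. emeasure (fock_measure \<alpha> f) (?D l))" by (simp add: sum_distrib_left)
  also have "\<dots> \<le> 2 * (\<Sum>\<^sub>\<infinity>l\<in>\<Lambda>. emeasure (fock_measure \<alpha> f) (?D l))"
    by (intro mult_left_mono sum_le_infsum_ennreal F) simp
  also have "\<dots> \<le> 2 * (overlap \<alpha> \<Lambda> m * emeasure (fock_measure \<alpha> f) (\<Union>l\<in>\<Lambda>. ?D l))"
    by (intro mult_left_mono infsum_emeasure_le_overlap) simp_all
  finally show "(\<Sum>l\<in>F. ennreal (quotient_norm2 \<alpha> l (m l) f))
    \<le> 2 * (overlap \<alpha> \<Lambda> m * emeasure (fock_measure \<alpha> f) (\<Union>l\<in>\<Lambda>. ?D l))" .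
qed

section \<open>Normalized reproducing kernels as test functions\<close>

lemma one_mem_fock: "(\<lambda>_. 1) \<in> fock \<alpha>"
  using monomial_mem_fock[OF \<alpha>, of 0] by simp

lemma fock_norm2_one: "fock_norm2 \<alpha> (\<lambda>_. 1) = 1"
proof -
  have "complex_of_real (LINT z|lborel. gauss \<alpha> z) = 1"
    using integral_monomial_fock[OF \<alpha> one_mem_fock, of 0] by simp
  then have "(LINT z|lborel. gauss \<alpha> z) = 1" by (simp only: of_real_eq_1_iff)
  then show ?thesis by (simp add: fock_norm2_def gauss_def)
qed

lemma fock_norm2_kernel: "fock_norm2 \<alpha> (fock_translation \<alpha> z (\<lambda>_. 1)) = 1"
proof -
  have "ennreal (fock_norm2 \<alpha> (fock_translation \<alpha> z (\<lambda>_. 1))) = emeasure (fock_measure \<alpha> (\<lambda>_. 1)) UNIV"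
    by (simp add: emeasure_fock_UNIV[OF \<alpha>, symmetric] fock_translation_mem_fock[OF \<alpha>] one_mem_fock
        emeasure_fock_translation[OF \<alpha>])
  also have "\<dots> = ennreal 1" by (simp add: emeasure_fock_UNIV[OF \<alpha> one_mem_fock] fock_norm2_one)
  finally show ?thesis using fock_norm2_nonneg[OF \<alpha>] by (simp del: ennreal_1)
qed

text \<open>Translated by \<open>- l\<close>, the kernel is a multiple of an exponential
  \<open>exp (B * \<zeta>)\<close>; its normalized Taylor coefficients, squared, are the Poisson
  weights of mean \<open>\<alpha> * norm (z - l) ^ 2\<close>.\<close>

lemma quotient_norm2_kernel:
  "quotient_norm2 \<alpha> l n (fock_translation \<alpha> z (\<lambda>_. 1)) = poisson_cdf n (\<alpha> * (norm (z - l))\<^sup>2)"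
proof -
  define A where "A = exp (complex_of_real \<alpha> * cnj z * l - complex_of_real (\<alpha> / 2 * ((norm l)\<^sup>2 + (norm z)\<^sup>2)))"
  define B where "B = complex_of_real \<alpha> * cnj (z - l)"
  have t: "fock_translation \<alpha> (- l) (fock_translation \<alpha> z (\<lambda>_. 1)) = (\<lambda>\<zeta>. A * exp (B * \<zeta>))"
    by (simp add: fun_eq_iff fock_translation_def A_def B_def algebra_simps add_divide_distrib flip: exp_add)
  have A: "(norm A)\<^sup>2 = exp (- (\<alpha> * (norm (z - l))\<^sup>2))"
    unfolding A_def norm_exp_eq_Re exp_double[symmetric] norm_diff_sq
    by (simp add: algebra_simps)
  have "(norm (fock_coeff \<alpha> l k (fock_translation \<alpha> z (\<lambda>_. 1))))\<^sup>2
      = exp (- (\<alpha> * (norm (z - l))\<^sup>2)) * ((\<alpha> * (norm (z - l))\<^sup>2) ^ k / fact k)" for k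
  proof -
    have "(norm (fock_coeff \<alpha> l k (fock_translation \<alpha> z (\<lambda>_. 1))))\<^sup>2
        = (norm A)\<^sup>2 * ((norm B)\<^sup>2) ^ k / (fact k * \<alpha> ^ k)"
      using \<alpha> unfolding fock_coeff_def t higher_deriv_exp_linear
      by (simp add: norm_mult norm_divide norm_power power_divide power_mult_distrib
          power_mult[symmetric] mult.commute)
    also have "(norm B)\<^sup>2 = \<alpha> * (\<alpha> * (norm (z - l))\<^sup>2)"
      using \<alpha> by (simp add: B_def norm_mult power_mult_distrib power2_eq_square del: complex_cnj_diff)
    finally show ?thesis using \<alpha> by (simp add: A power_mult_distrib)
  qed
  then show ?thesis
    by (simp add: quotient_norm2_eq[OF \<alpha> fock_translation_mem_fock[OF \<alpha> one_mem_fock]]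
        poisson_cdf_def sum_distrib_left)
qed

lemma emeasure_kernel_outside:
  assumes "0 \<le> C"
  shows "emeasure (fock_measure \<alpha> (fock_translation \<alpha> z (\<lambda>_. 1))) (- ball z C) = ennreal (exp (- \<alpha> * C\<^sup>2))"
proof -
  let ?M = "fock_measure \<alpha> (\<lambda>_. 1)"
  have "emeasure (fock_measure \<alpha> (fock_translation \<alpha> z (\<lambda>_. 1))) (- ball z C) = emeasure ?M (- ball 0 C)"
    by (subst emeasure_fock_translation[OF \<alpha>])
       (auto simp: dist_norm intro!: arg_cong[where f="emeasure _"])
  also have "\<dots> = emeasure ?M UNIV - emeasure ?M (ball 0 C)"
  proof -
    have "emeasure ?M (ball 0 C) \<noteq> \<infinity>"
      by (subst emeasure_fock_ball_finite[OF \<alpha>]) (auto intro: holomorphic_intros)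
    then show ?thesis using emeasure_compl[of "ball 0 C" ?M] by (simp add: Compl_eq_Diff_UNIV)
  qed
  also have "emeasure ?M (ball 0 C) = ennreal (1 - exp (- \<alpha> * C\<^sup>2))"
    using nn_integral_gauss_monomial_ball[OF \<alpha> assms, of 0]
    by (subst emeasure_fock_measure[OF \<alpha>]) (auto simp: poisson_cdf_def)
  also have "emeasure ?M UNIV = ennreal 1"
    by (simp add: emeasure_fock_UNIV[OF \<alpha> one_mem_fock] fock_norm2_one)
  also have "ennreal 1 - ennreal (1 - exp (- \<alpha> * C\<^sup>2)) = ennreal (exp (- \<alpha> * C\<^sup>2))"
    using \<alpha> by (subst ennreal_minus) auto
  finally show ?thesis .
qed

text \<open>If a disc contains \<open>z\<close>, then
  \<open>\<alpha> * norm (z - l) ^ 2 <= m l\<close>, so it contributes at least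
  \<open>exp (- 1)\<close> to the quotient sum of the unit-norm kernel at \<open>z\<close>. Hence at
  most \<open>exp 1 * C'\<close> discs contain \<open>z\<close>.\<close>

lemma sampling_imp_finite_overlap:
  assumes "sampling_divisor \<alpha> \<Lambda> m"
  shows "finite_overlap \<alpha> \<Lambda> m"
proof -
  from assms obtain C' where C': "\<And>f. f \<in> fock \<alpha> \<Longrightarrow>
      (\<Sum>\<^sub>\<infinity>l\<in>\<Lambda>. ennreal (quotient_norm2 \<alpha> l (m l) f)) \<le> ennreal (C' * fock_norm2 \<alpha> f)"
    and m: "\<And>l. l \<in> \<Lambda> \<Longrightarrow> 1 \<le> m l"
    by (auto simp: sampling_divisor_def divisor_def)
  have "overlap \<alpha> \<Lambda> m \<le> ennreal (exp 1) * ennreal C'"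
    unfolding overlap_def
  proof (intro SUP_least infsum_ennreal_le)
    fix z F assume F: "finite F" "F \<subseteq> \<Lambda>"
    let ?K = "fock_translation \<alpha> z (\<lambda>_. 1)"
    have "(\<Sum>l\<in>F. indicator (ball l (sqrt (real (m l) / \<alpha>))) z)
        \<le> (\<Sum>l\<in>F. ennreal (exp 1) * ennreal (quotient_norm2 \<alpha> l (m l) ?K))"
    proof (rule sum_mono)
      fix l assume l: "l \<in> F"
      show "indicator (ball l (sqrt (real (m l) / \<alpha>))) z \<le> ennreal (exp 1) * ennreal (quotient_norm2 \<alpha> l (m l) ?K)"
      proof (cases "z \<in> ball l (sqrt (real (m l) / \<alpha>))")
        case True
        then have "norm (z - l) < sqrt (real (m l) / \<alpha>)" by (simp add: dist_norm norm_minus_commute)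
        then have "(norm (z - l))\<^sup>2 < real (m l) / \<alpha>"
          using real_sqrt_less_iff[of "(norm (z - l))\<^sup>2" "real (m l) / \<alpha>"] by simp
        then have "\<alpha> * (norm (z - l))\<^sup>2 \<le> real (m l)" using \<alpha> by (simp add: field_simps)
        then have "poisson_cdf (m l) (real (m l)) \<le> poisson_cdf (m l) (\<alpha> * (norm (z - l))\<^sup>2)"
          using \<alpha> by (intro poisson_cdf_antimono) auto
        then have "exp (- 1) \<le> quotient_norm2 \<alpha> l (m l) ?K"
          using poisson_cdf_ge_inverse_exp[of "m l"] m[of l] l F by (auto simp: quotient_norm2_kernel)
        then have "1 \<le> exp 1 * quotient_norm2 \<alpha> l (m l) ?K"
          by (simp add: exp_minus field_simps)
        then have "ennreal 1 \<le> ennreal (exp 1 * quotient_norm2 \<alpha> l (m l) ?K)" by (rule ennreal_leI)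
        then show ?thesis using True by (simp add: ennreal_mult')
      qed simp
    qed
    also have "\<dots> = ennreal (exp 1) * (\<Sum>l\<in>F. ennreal (quotient_norm2 \<alpha> l (m l) ?K))"
      by (simp only: sum_distrib_left)
    also have "\<dots> \<le> ennreal (exp 1) * (\<Sum>\<^sub>\<infinity>l\<in>\<Lambda>. ennreal (quotient_norm2 \<alpha> l (m l) ?K))"
      by (intro mult_left_mono sum_le_infsum_ennreal F) simp
    also have "\<dots> \<le> ennreal (exp 1) * ennreal C'"
      using C'[OF fock_translation_mem_fock[OF \<alpha> one_mem_fock], of z]
      by (intro mult_left_mono) (simp_all add: fock_norm2_kernel)
    finally show "(\<Sum>l\<in>F. indicator (ball l (sqrt (real (m l) / \<alpha>))) z) \<le> ennreal (exp 1) * ennreal C'" .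
  qed
  also have "\<dots> < \<infinity>" by (simp add: ennreal_mult_less_top)
  finally show ?thesis unfolding finite_overlap_def .
qed

lemma sampling_imp_cover:
  assumes "sampling_divisor \<alpha> \<Lambda> m"
  shows "\<exists>C>0. (\<Union>l\<in>\<Lambda>. ball l (sqrt (real (m l) / \<alpha>) + C)) = UNIV"
proof -
  from assms obtain c where c: "0 < c" "\<And>f. f \<in> fock \<alpha> \<Longrightarrow>
      ennreal (c * fock_norm2 \<alpha> f) \<le> (\<Sum>\<^sub>\<infinity>l\<in>\<Lambda>. ennreal (quotient_norm2 \<alpha> l (m l) f))"
    and div: "divisor \<Lambda> m"
    by (auto simp: sampling_divisor_def)
  define S where "S = enn2real (overlap \<alpha> \<Lambda> m)"
  have S: "overlap \<alpha> \<Lambda> m = ennreal S" "0 \<le> S"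
    using sampling_imp_finite_overlap[OF assms] by (auto simp: S_def finite_overlap_def)
  \<comment> \<open>It suffices that \<open>2 * S * exp (- \<alpha> * C^2) < c\<close>; with this
    value that follows from \<open>exp x >= 1 + x\<close>.\<close>
  define C where "C = sqrt (2 * (S + 1) / c / \<alpha>)"
  have C: "0 < C" "\<alpha> * C\<^sup>2 = 2 * (S + 1) / c" using c \<alpha> S(2) by (auto simp: C_def)
  have small: "2 * (S * exp (- \<alpha> * C\<^sup>2)) < c"
  proof -
    have "2 * (S + 1) / c < exp (\<alpha> * C\<^sup>2)"
      unfolding C(2)[symmetric] using exp_ge_add_one_self[of "\<alpha> * C\<^sup>2"] by linarith
    then show ?thesis using c S(2) by (simp add: exp_minus field_simps)
  qed
  have "(\<Union>l\<in>\<Lambda>. ball l (sqrt (real (m l) / \<alpha>) + C)) = UNIV"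
  proof (rule ccontr)
    assume "\<not> ?thesis"
    \<comment> \<open>For an uncovered \<open>z\<close> all discs of the divisor avoid the ball of
      radius \<open>C\<close> around \<open>z\<close>, and outside that ball the kernel has only
      mass \<open>exp (- \<alpha> * C^2)\<close>.\<close>
    then obtain z where z: "\<And>l. l \<in> \<Lambda> \<Longrightarrow> sqrt (real (m l) / \<alpha>) + C \<le> dist l z"
      by (auto simp: not_less set_eq_iff)
    let ?K = "fock_translation \<alpha> z (\<lambda>_. 1)"
    have K: "?K \<in> fock \<alpha>" by (rule fock_translation_mem_fock[OF \<alpha> one_mem_fock])
    have "ennreal c \<le> (\<Sum>\<^sub>\<infinity>l\<in>\<Lambda>. ennreal (quotient_norm2 \<alpha> l (m l) ?K))"
      using c(2)[OF K] by (simp add: fock_norm2_kernel)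
    also have "\<dots> \<le> 2 * (overlap \<alpha> \<Lambda> m * emeasure (fock_measure \<alpha> ?K) (\<Union>l\<in>\<Lambda>. ball l (sqrt (real (m l) / \<alpha>))))"
      by (rule infsum_quotient_norm2_le[OF K div])
    also have "\<dots> \<le> 2 * (overlap \<alpha> \<Lambda> m * emeasure (fock_measure \<alpha> ?K) (- ball z C))"
    proof (intro mult_left_mono emeasure_mono)
      show "(\<Union>l\<in>\<Lambda>. ball l (sqrt (real (m l) / \<alpha>))) \<subseteq> - ball z C"
      proof clarify
        fix w l assume l: "l \<in> \<Lambda>" "w \<in> ball l (sqrt (real (m l) / \<alpha>))" "w \<in> ball z C"
        have "dist l z \<le> dist l w + dist z w" by (rule dist_triangle2)
        then show False using l z[OF l(1)] by simp
      qed
    qed auto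
    also have "\<dots> = ennreal (2 * (S * exp (- \<alpha> * C\<^sup>2)))"
      using C S by (simp add: emeasure_kernel_outside ennreal_mult)
    also have "\<dots> < ennreal c" using small c by (intro ennreal_lessI)
    finally show False by simp
  qed
  with C show ?thesis by blast
qed

end

section \<open>Zeros of entire functions\<close>

lemma holomorphic_divide_root:
  assumes "u holomorphic_on UNIV" "u a = 0"
  obtains v where "v holomorphic_on UNIV" "\<And>z. u z = (z - a) * v z"
proof
  show "(\<lambda>z. if z = a then deriv u a else (u z - u a) / (z - a)) holomorphic_on UNIV"
    by (rule pole_lemma[of u UNIV a]) (use assms in auto)
  show "u z = (z - a) * (if z = a then deriv u a else (u z - u a) / (z - a))" for z
    using assms by simp
qed

lemma holomorphic_cancel_root:
  fixes u v :: "complex \<Rightarrow> complex"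
  assumes "u holomorphic_on UNIV" "v holomorphic_on UNIV" "\<And>z. (z - a) * u z = (z - a) * v z"
  shows "u = v"
proof
  fix z
  show "u z = v z"
  proof (cases "z = a")
    case True
    have "isCont u a" "isCont v a"
      using assms(1,2) by (auto dest!: holomorphic_on_imp_continuous_on simp: continuous_on_eq_continuous_at)
    then have "isCont (\<lambda>z. u z - v z) a" by (rule continuous_diff)
    then have 1: "((\<lambda>z. u z - v z) \<longlongrightarrow> u a - v a) (at a)" by (simp add: isCont_def)
    have "\<forall>\<^sub>F z in at a. u z - v z = 0"
      using assms(3) by (auto simp: eventually_at intro!: exI[of _ 1])
    then have 2: "((\<lambda>z. u z - v z) \<longlongrightarrow> 0) (at a)" by (rule tendsto_eventually)
    have "u a - v a = 0" by (rule tendsto_unique[OF at_neq_bot 1 2])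
    then show ?thesis using True by simp
  qed (use assms(3)[of z] in simp)
qed

lemma higher_deriv_ident_times:
  assumes "u holomorphic_on UNIV"
  shows "(deriv ^^ k) (\<lambda>z. z * u z) = (\<lambda>z. z * (deriv ^^ k) u z + of_nat k * (deriv ^^ (k - 1)) u z)"
proof (induction k)
  case (Suc k)
  have d: "((deriv ^^ j) u has_field_derivative (deriv ^^ Suc j) u z) (at z)" for j z
    using holomorphic_higher_deriv[OF assms, of j] by (auto intro!: holomorphic_derivI)
  have "deriv (\<lambda>z. z * (deriv ^^ k) u z + of_nat k * (deriv ^^ (k - 1)) u z) z
      = z * (deriv ^^ Suc k) u z + of_nat (Suc k) * (deriv ^^ k) u z" for z
  proof (cases k)
    case 0
    show ?thesis unfolding 0
      by (rule DERIV_imp_deriv) (use d[of 0 z] in \<open>auto intro!: derivative_eq_intros\<close>)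
  next
    case (Suc j)
    have "((\<lambda>z. z * (deriv ^^ k) u z + of_nat k * (deriv ^^ j) u z) has_field_derivative
        (1 * (deriv ^^ k) u z + (deriv ^^ Suc k) u z * z + of_nat k * (deriv ^^ Suc j) u z)) (at z)"
      by (intro DERIV_add DERIV_mult DERIV_cmult DERIV_ident d)
    then have "deriv (\<lambda>z. z * (deriv ^^ k) u z + of_nat k * (deriv ^^ j) u z) z
        = 1 * (deriv ^^ k) u z + (deriv ^^ Suc k) u z * z + of_nat k * (deriv ^^ Suc j) u z"
      by (rule DERIV_imp_deriv)
    then show ?thesis using Suc by (simp add: algebra_simps)
  qed
  then show ?case by (simp add: Suc.IH)
qed simp

text \<open>Induction strips one factor \<open>z\<close> at a time: by the product rule, the
  \<open>k\<close>-th derivative of \<open>z * v z\<close> at 0 is \<open>k\<close> times the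
  derivative of \<open>v\<close> of order \<open>k - 1\<close>.\<close>

lemma higher_deriv_zero_iff_factor:
  assumes "u holomorphic_on UNIV"
  shows "(\<forall>k<n. (deriv ^^ k) u 0 = 0) \<longleftrightarrow> (\<exists>q. q holomorphic_on UNIV \<and> (\<forall>z. u z = z ^ n * q z))"
  using assms
proof (induction n arbitrary: u)
  case 0
  then show ?case by auto
next
  case (Suc n)
  have step: "(\<forall>k<Suc n. (deriv ^^ k) u 0 = 0) \<longleftrightarrow> (\<exists>q. q holomorphic_on UNIV \<and> (\<forall>z. v z = z ^ n * q z))"
    if v: "v holomorphic_on UNIV" "\<And>z. u z = z * v z" for v
  proof -
    have u: "u = (\<lambda>z. z * v z)" using v by blast
    have "(deriv ^^ k) u 0 = of_nat k * (deriv ^^ (k - 1)) v 0" for k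
      unfolding u by (simp add: higher_deriv_ident_times[OF v(1)])
    then have "(\<forall>k<Suc n. (deriv ^^ k) u 0 = 0) \<longleftrightarrow> (\<forall>k<n. (deriv ^^ k) v 0 = 0)"
      by (auto simp: less_Suc_eq_0_disj)
    then show ?thesis using Suc.IH[OF v(1)] by blast
  qed
  show ?case
  proof
    assume L: "\<forall>k<Suc n. (deriv ^^ k) u 0 = 0"
    then have "u 0 = 0" by (auto dest: spec[of _ 0])
    then obtain v where v: "v holomorphic_on UNIV" "\<And>z. u z = (z - 0) * v z"
      using holomorphic_divide_root[OF Suc.prems] by blast
    with step[of v] L obtain q where "q holomorphic_on UNIV" "\<forall>z. v z = z ^ n * q z" by auto
    with v show "\<exists>q. q holomorphic_on UNIV \<and> (\<forall>z. u z = z ^ Suc n * q z)"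
      by (auto simp: mult.assoc)
  next
    assume "\<exists>q. q holomorphic_on UNIV \<and> (\<forall>z. u z = z ^ Suc n * q z)"
    then obtain q where q: "q holomorphic_on UNIV" "\<And>z. u z = z ^ Suc n * q z" by blast
    show "\<forall>k<Suc n. (deriv ^^ k) u 0 = 0"
      by (rule step[of "\<lambda>z. z ^ n * q z", THEN iffD2])
         (use q in \<open>auto intro!: holomorphic_intros simp: mult.assoc\<close>)
  qed
qed

lemma fock_translation_inverse: "fock_translation \<alpha> l (fock_translation \<alpha> (- l) f) = f"
proof
  fix z
  have "complex_of_real \<alpha> * cnj l * z - complex_of_real (\<alpha> / 2 * (norm l)\<^sup>2)
      + (complex_of_real \<alpha> * cnj (- l) * (z - l) - complex_of_real (\<alpha> / 2 * (norm (- l))\<^sup>2)) = 0"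
    unfolding norm_minus_cancel of_real_mult complex_norm_square by (simp add: algebra_simps)
  then show "fock_translation \<alpha> l (fock_translation \<alpha> (- l) f) z = f z"
    unfolding fock_translation_def mult.assoc[symmetric] exp_add[symmetric]
    by (simp del: norm_minus_cancel)
qed

lemma emeasure_fock_mono_norm:
  assumes "\<alpha> > 0" "f holomorphic_on UNIV" "h holomorphic_on UNIV" and [measurable]: "A \<in> sets borel"
    and "\<And>z. z \<in> A \<Longrightarrow> norm (h z) \<le> B * norm (f z)"
  shows "emeasure (fock_measure \<alpha> h) A \<le> ennreal (B\<^sup>2) * emeasure (fock_measure \<alpha> f) A"
proof -
  note [measurable] = holomorphic_measurable[OF assms(2)]
  have "emeasure (fock_measure \<alpha> h) A
      \<le> (\<integral>\<^sup>+z. ennreal (B\<^sup>2) * (ennreal ((norm (f z))\<^sup>2 * gauss \<alpha> z) * indicator A z) \<partial>lborel)"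
    unfolding emeasure_fock_measure[OF assms(1,3,4)]
  proof (rule nn_integral_mono)
    fix z
    have "(norm (h z))\<^sup>2 * gauss \<alpha> z \<le> B\<^sup>2 * ((norm (f z))\<^sup>2 * gauss \<alpha> z)" if "z \<in> A"
      using power_mono[OF assms(5)[OF that], of 2] gauss_nonneg[OF assms(1), of z]
      by (simp add: power_mult_distrib mult_right_mono flip: mult.assoc)
    then show "ennreal ((norm (h z))\<^sup>2 * gauss \<alpha> z) * indicator A z
        \<le> ennreal (B\<^sup>2) * (ennreal ((norm (f z))\<^sup>2 * gauss \<alpha> z) * indicator A z)"
      by (auto split: split_indicator simp flip: ennreal_mult' intro!: ennreal_leI)
  qed
  also have "\<dots> = ennreal (B\<^sup>2) * emeasure (fock_measure \<alpha> f) A"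
    by (simp add: nn_integral_cmult emeasure_fock_measure assms)
  finally show ?thesis .
qed

lemma fock_coeff_zero_iff:
  assumes "\<alpha> > 0"
  shows "fock_coeff \<alpha> l k f = 0 \<longleftrightarrow> (deriv ^^ k) (fock_translation \<alpha> (- l) f) 0 = 0"
  using assms by (simp add: fock_coeff_def)

text \<open>The exponential in the translation has no zeros, so it does not affect the order of
  vanishing. Null conditions are stated with coefficients but multiplied and divided as
  factorizations.\<close>

lemma fock_coeff_zero_iff_factor:
  assumes "\<alpha> > 0" "f holomorphic_on UNIV"
  shows "(\<forall>k<n. fock_coeff \<alpha> l k f = 0) \<longleftrightarrow> (\<exists>g. g holomorphic_on UNIV \<and> (\<forall>z. f z = (z - l) ^ n * g z))"
  unfolding fock_coeff_zero_iff[OF assms(1)]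
    higher_deriv_zero_iff_factor[OF holomorphic_fock_translation[OF assms(2)]]
proof safe
  fix q assume q: "q holomorphic_on UNIV" "\<forall>z. fock_translation \<alpha> (- l) f z = z ^ n * q z"
  have "f z = (z - l) ^ n * fock_translation \<alpha> l q z" for z
  proof -
    have "f z = fock_translation \<alpha> l (fock_translation \<alpha> (- l) f) z" by (simp only: fock_translation_inverse)
    also have "\<dots> = (z - l) ^ n * fock_translation \<alpha> l q z"
      by (simp only: fock_translation_def[of \<alpha> l] q(2)[rule_format]) (simp only: mult_ac)
    finally show ?thesis .
  qed
  then show "\<exists>g. g holomorphic_on UNIV \<and> (\<forall>z. f z = (z - l) ^ n * g z)"
    using holomorphic_fock_translation[OF q(1)] by blast
next
  fix g assume g: "g holomorphic_on UNIV" "\<forall>z. f z = (z - l) ^ n * g z"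
  have "fock_translation \<alpha> (- l) f z = z ^ n * fock_translation \<alpha> (- l) g z" for z
    by (simp add: fock_translation_def g)
  then show "\<exists>q. q holomorphic_on UNIV \<and> (\<forall>z. fock_translation \<alpha> (- l) f z = z ^ n * q z)"
    using holomorphic_fock_translation[OF g(1)] by blast
qed

text \<open>All Poisson tails in the local series are strictly positive, so a null disc forces every
  coefficient at its centre to vanish.\<close>

lemma fock_null_ball_imp_zero:
  assumes "\<alpha> > 0" "f holomorphic_on UNIV" "0 < r" "emeasure (fock_measure \<alpha> f) (ball l r) = 0"
  shows "f = (\<lambda>_. 0)"
proof -
  let ?a = "\<lambda>k. (norm (fock_coeff \<alpha> l k f))\<^sup>2 * (1 - poisson_cdf (Suc k) (\<alpha> * r\<^sup>2))"
  have x: "0 < \<alpha> * r\<^sup>2" using assms(1,3) by simp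
  have lt: "poisson_cdf (Suc k) (\<alpha> * r\<^sup>2) < 1" for k
  proof -
    have "0 < exp (- (\<alpha> * r\<^sup>2)) * ((\<alpha> * r\<^sup>2) ^ Suc k / fact (Suc k))"
      by (intro mult_pos_pos divide_pos_pos zero_less_power x) auto
    then show ?thesis
      using poisson_cdf_le_1[of "\<alpha> * r\<^sup>2" "Suc (Suc k)"] x
      unfolding poisson_cdf_Suc[of "Suc k"] by linarith
  qed
  have "?a sums 0"
    using fock_coeff_sums[OF assms(1,2), of r l] assms(3,4) by (simp add: measure_def)
  then have "\<forall>k. ?a k = 0"
    using lt by (intro suminf_eq_zero_iff[THEN iffD1]) (auto simp: sums_iff less_imp_le)
  then have "(deriv ^^ k) (fock_translation \<alpha> (- l) f) 0 = 0" for k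
    using lt[of k] fock_coeff_zero_iff[OF assms(1), of l k f] by auto
  then have "fock_translation \<alpha> (- l) f z = 0" for z
    using taylor_sums[OF holomorphic_fock_translation[OF assms(2), of \<alpha> "- l"], of z]
    by (simp add: sums_unique2[OF _ sums_zero])
  then have "fock_translation \<alpha> l (fock_translation \<alpha> (- l) f) = (\<lambda>_. 0)"
    unfolding fock_translation_def[of \<alpha> l] by simp
  then show ?thesis by (simp only: fock_translation_inverse)
qed

section \<open>Sufficiency\<close>

lemma fock_mass_tendsto:
  assumes "\<alpha> > 0" "\<And>n. g n holomorphic_on UNIV" "G holomorphic_on UNIV" and [measurable]: "A \<in> sets borel"
    and bound: "\<And>n z. z \<in> A \<Longrightarrow> norm (g n z) \<le> B" and lim: "\<And>z. (\<lambda>n. g n z) \<longlonglongrightarrow> G z"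
  shows "(\<lambda>n. emeasure (fock_measure \<alpha> (g n)) A) \<longlonglongrightarrow> emeasure (fock_measure \<alpha> G) A"
  unfolding emeasure_fock_measure[OF assms(1,2,4)] emeasure_fock_measure[OF assms(1,3,4)]
proof (rule nn_integral_dominated_convergence[where w="\<lambda>z. ennreal (B\<^sup>2) * ennreal (gauss \<alpha> z)"])
  note [measurable] = holomorphic_measurable[OF assms(2)] holomorphic_measurable[OF assms(3)]
  show "(\<lambda>z. ennreal ((norm (g n z))\<^sup>2 * gauss \<alpha> z) * indicator A z) \<in> borel_measurable lborel" for n
    by measurable
  show "(\<lambda>z. ennreal ((norm (G z))\<^sup>2 * gauss \<alpha> z) * indicator A z) \<in> borel_measurable lborel"
    by measurable
  show "AE z in lborel. ennreal ((norm (g n z))\<^sup>2 * gauss \<alpha> z) * indicator A z \<le> ennreal (B\<^sup>2) * ennreal (gauss \<alpha> z)" for n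
  proof (rule AE_I2)
    fix z
    show "ennreal ((norm (g n z))\<^sup>2 * gauss \<alpha> z) * indicator A z \<le> ennreal (B\<^sup>2) * ennreal (gauss \<alpha> z)"
      using power_mono[OF bound[of z n], of 2] gauss_nonneg[OF assms(1), of z]
      by (auto split: split_indicator simp flip: ennreal_mult' intro!: ennreal_leI mult_right_mono)
  qed
  have "(\<integral>\<^sup>+z. ennreal (gauss \<alpha> z) \<partial>lborel) = emeasure (fock_measure \<alpha> (\<lambda>_. 1)) UNIV"
    by (subst emeasure_fock_measure[OF assms(1)]) auto
  also have "\<dots> < \<infinity>" using one_mem_fock[OF assms(1)] by (simp add: mem_fock_iff[OF assms(1)])
  finally show "(\<integral>\<^sup>+z. ennreal (B\<^sup>2) * ennreal (gauss \<alpha> z) \<partial>lborel) < \<infinity>"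
    by (simp add: nn_integral_cmult ennreal_mult_less_top)
  show "AE z in lborel. (\<lambda>n. ennreal ((norm (g n z))\<^sup>2 * gauss \<alpha> z) * indicator A z)
      \<longlonglongrightarrow> ennreal ((norm (G z))\<^sup>2 * gauss \<alpha> z) * indicator A z"
  proof (rule AE_I2)
    fix z
    have "(\<lambda>n. ennreal ((norm (g n z))\<^sup>2 * gauss \<alpha> z)) \<longlonglongrightarrow> ennreal ((norm (G z))\<^sup>2 * gauss \<alpha> z)"
      by (intro tendsto_ennrealI tendsto_intros lim)
    then show "(\<lambda>n. ennreal ((norm (g n z))\<^sup>2 * gauss \<alpha> z) * indicator A z)
      \<longlonglongrightarrow> ennreal ((norm (G z))\<^sup>2 * gauss \<alpha> z) * indicator A z"
      by (auto split: split_indicator)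
  qed
qed measurable

text \<open>A coefficient is a derivative of the translated function, and the exponential factor is
  bounded on the unit disc. Locally uniform convergence is what Montel's theorem provides; its
  limits need not be limits in norm.\<close>

lemma fock_coeff_tendsto:
  assumes "\<And>n. g n holomorphic_on UNIV" "uniform_limit (cball l 1) g G sequentially"
  shows "(\<lambda>n. fock_coeff \<alpha> l k (g n)) \<longlonglongrightarrow> fock_coeff \<alpha> l k G"
proof -
  define E where "E \<zeta> = exp (complex_of_real \<alpha> * cnj (- l) * \<zeta> - complex_of_real (\<alpha> / 2 * (norm (- l))\<^sup>2))" for \<zeta>
  have T: "fock_translation \<alpha> (- l) f = (\<lambda>\<zeta>. E \<zeta> * f (\<zeta> + l))" for f
    by (simp add: fun_eq_iff fock_translation_def E_def)
  have "compact (E ` cball 0 1)"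
    unfolding E_def by (intro compact_continuous_image continuous_intros) auto
  then obtain B where B: "0 < B" "\<forall>x\<in>E ` cball 0 1. norm x \<le> B"
    using compact_imp_bounded bounded_pos by blast
  have "uniform_limit (ball 0 1) (\<lambda>n. fock_translation \<alpha> (- l) (g n)) (fock_translation \<alpha> (- l) G) sequentially"
  proof (rule uniform_limitI)
    fix e :: real assume "0 < e"
    then have "\<forall>\<^sub>F n in sequentially. \<forall>z\<in>cball l 1. dist (g n z) (G z) < e / B"
      using assms(2) B(1) unfolding uniform_limit_iff by simp
    then show "\<forall>\<^sub>F n in sequentially. \<forall>\<zeta>\<in>ball 0 1.
        dist (fock_translation \<alpha> (- l) (g n) \<zeta>) (fock_translation \<alpha> (- l) G \<zeta>) < e"
    proof (rule eventually_mono, intro ballI)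
      fix n \<zeta> assume n: "\<forall>z\<in>cball l 1. dist (g n z) (G z) < e / B" and z: "\<zeta> \<in> ball (0::complex) 1"
      have "dist (g n (\<zeta> + l)) (G (\<zeta> + l)) < e / B" using n z by (simp add: dist_norm)
      moreover have "norm (E \<zeta>) \<le> B" using B(2) z by simp
      ultimately have "norm (E \<zeta>) * dist (g n (\<zeta> + l)) (G (\<zeta> + l)) < B * (e / B)"
        using B(1) by (intro mult_le_less_imp_less) (auto simp: E_def)
      then show "dist (fock_translation \<alpha> (- l) (g n) \<zeta>) (fock_translation \<alpha> (- l) G \<zeta>) < e"
        using B(1) by (simp add: T dist_norm norm_mult flip: right_diff_distrib)
    qed
  qed
  then have "(\<lambda>n. (deriv ^^ k) (fock_translation \<alpha> (- l) (g n)) 0) \<longlonglongrightarrow> (deriv ^^ k) (fock_translation \<alpha> (- l) G) 0"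
    by (rule higher_deriv_complex_uniform_limit)
       (auto intro!: always_eventually holomorphic_on_subset[OF holomorphic_fock_translation[OF assms(1)]])
  then show ?thesis
    unfolding fock_coeff_def divide_inverse by (rule tendsto_mult_right)
qed

text \<open>The coefficient of order 0 at \<open>z\<close> is \<open>f z\<close> times
  \<open>exp (- (\<alpha> / 2 * norm z ^ 2))\<close>, and the disc estimate with
  \<open>m = 1\<close> bounds its square by 2. This is the local boundedness for Montel's
  theorem.\<close>

lemma fock_pointwise_bound:
  assumes "\<alpha> > 0" "f holomorphic_on UNIV" "emeasure (fock_measure \<alpha> f) UNIV \<le> 1"
  shows "(norm (f z))\<^sup>2 \<le> 2 * exp (\<alpha> * (norm z)\<^sup>2)"
proof -
  have "emeasure (fock_measure \<alpha> f) (ball z (sqrt (real 1 / \<alpha>))) \<le> 1"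
    by (rule order_trans[OF emeasure_mono assms(3)]) auto
  then have "measure (fock_measure \<alpha> f) (ball z (sqrt (real 1 / \<alpha>))) \<le> 1"
    unfolding emeasure_fock_ball_finite[OF assms(1,2)] by simp
  then have "(norm (fock_coeff \<alpha> z 0 f))\<^sup>2 \<le> 2"
    using sum_fock_coeff_le_mass[OF assms(1,2), of 1 z] by simp
  moreover have "(norm (fock_coeff \<alpha> z 0 f))\<^sup>2 = exp (- (\<alpha> * (norm z)\<^sup>2)) * (norm (f z))\<^sup>2"
  proof -
    have "fock_coeff \<alpha> z 0 f = exp (complex_of_real (- (\<alpha> / 2 * (norm z)\<^sup>2))) * f z"
      by (simp add: fock_coeff_def fock_translation_def)
    then show ?thesis
      by (simp only: norm_mult norm_exp_eq_Re Re_complex_of_real power_mult_distrib exp_double[symmetric]) simp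
  qed
  ultimately show ?thesis by (simp add: exp_minus field_simps)
qed

lemma fock_cmult:
  assumes "\<alpha> > 0" "f \<in> fock \<alpha>"
  shows "(\<lambda>z. c * f z) \<in> fock \<alpha>" "fock_coeff \<alpha> l k (\<lambda>z. c * f z) = c * fock_coeff \<alpha> l k f"
proof -
  have h: "f holomorphic_on UNIV" "(\<lambda>z. c * f z) holomorphic_on UNIV"
    using fock_holomorphic[OF assms] by (auto intro!: holomorphic_intros)
  have "emeasure (fock_measure \<alpha> (\<lambda>z. c * f z)) UNIV \<le> ennreal ((norm c)\<^sup>2) * emeasure (fock_measure \<alpha> f) UNIV"
    by (rule emeasure_fock_mono_norm[OF assms(1) h]) (auto simp: norm_mult)
  also have "\<dots> < \<infinity>" using assms by (simp add: mem_fock_iff ennreal_mult_less_top)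
  finally show cf: "(\<lambda>z. c * f z) \<in> fock \<alpha>" using h by (simp add: mem_fock_iff[OF assms(1)])
  show "fock_coeff \<alpha> l k (\<lambda>z. c * f z) = c * fock_coeff \<alpha> l k f"
    unfolding fock_inner_translation_basis[OF assms(1) cf, symmetric] fock_inner_translation_basis[OF assms, symmetric]
    by (simp add: fock_inner_def mult.assoc mult.left_commute[of _ c])
qed

text \<open>\<open>S\<close> is the overlap as a real number, and \<open>small\<close> makes the
  errors of all shrunken discs together at most half of the norm. The condition
  \<open>real (m l) > \<alpha> * C^2\<close> says that the radius exceeds \<open>C\<close>.\<close>

locale large_disc_cover =
  fixes \<alpha> C S :: real and \<Lambda> :: "complex set" and m :: "complex \<Rightarrow> nat" and K :: "complex set"
  assumes \<alpha>: "\<alpha> > 0" and C: "C > 0" and S: "0 \<le> S" "overlap \<alpha> \<Lambda> m = ennreal S"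
    and small: "S * exp (- 2 * \<alpha> * C\<^sup>2) \<le> 1 / 2"
    and div: "divisor \<Lambda> m" and K: "compact K"
    and cover: "UNIV - K \<subseteq> (\<Union>l\<in>{l\<in>\<Lambda>. real (m l) > \<alpha> * C\<^sup>2}. ball l (sqrt (real (m l) / \<alpha>) - C))"
begin

definition R :: "complex \<Rightarrow> real" where "R l = sqrt (real (m l) / \<alpha>)"

definition L :: "complex set" where "L = {l\<in>\<Lambda>. real (m l) > \<alpha> * C\<^sup>2}"

lemma L: "L \<subseteq> \<Lambda>" "countable L" "l \<in> L \<Longrightarrow> 1 \<le> m l" "l \<in> L \<Longrightarrow> C < R l"
proof -
  show "L \<subseteq> \<Lambda>" by (auto simp: L_def)
  then show "countable L" using div countable_subset by (auto simp: divisor_def)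
  show "1 \<le> m l" if "l \<in> L" using that div by (auto simp: divisor_def L_def)
  show "C < R l" if "l \<in> L"
    using that \<alpha> C unfolding R_def L_def by (intro real_less_rsqrt) (auto simp: field_simps)
qed

lemma K_borel [measurable]: "K \<in> sets borel"
  using K by (rule borel_compact)

text \<open>The local estimate is summed over finite sets of discs. The masses of the full discs add
  up to at most \<open>S\<close> times the total mass, which turns the error into one half of it.
  The cut-off \<open>n l\<close> may be \<open>m l - 1\<close> where a zero has been
  removed.\<close>

lemma mass_outside_le:
  assumes h: "f holomorphic_on UNIV" and n: "\<And>l. l \<in> L \<Longrightarrow> m l \<le> Suc (n l)"
  shows "emeasure (fock_measure \<alpha> f) (UNIV - K)
    \<le> (\<Sum>\<^sub>\<infinity>l\<in>L. ennreal (\<Sum>k<n l. (norm (fock_coeff \<alpha> l k f))\<^sup>2))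
      + ennreal (1 / 2) * emeasure (fock_measure \<alpha> f) UNIV"
proof -
  let ?M = "fock_measure \<alpha> f"
  let ?q = "\<lambda>l. \<Sum>k<n l. (norm (fock_coeff \<alpha> l k f))\<^sup>2"
  define e where "e = exp (- 2 * \<alpha> * C\<^sup>2)"
  have "emeasure ?M (UNIV - K) \<le> emeasure ?M (\<Union>l\<in>L. ball l (R l - C))"
    using cover by (intro emeasure_mono) (auto simp: L_def R_def intro!: borel_open)
  also have "\<dots> \<le> (\<Sum>\<^sub>\<infinity>l\<in>L. emeasure ?M (ball l (R l - C)))"
    by (rule emeasure_UN_le_infsum) (auto simp: L)
  also have "\<dots> \<le> (\<Sum>\<^sub>\<infinity>l\<in>L. ennreal (?q l)) + ennreal (1 / 2) * emeasure ?M UNIV"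
  proof (rule infsum_ennreal_le)
    fix F assume F: "finite F" "F \<subseteq> L"
    have "(\<Sum>l\<in>F. emeasure ?M (ball l (R l - C))) \<le> (\<Sum>l\<in>F. ennreal (?q l) + ennreal e * emeasure ?M (ball l (R l)))"
    proof (rule sum_mono)
      fix l assume "l \<in> F"
      then have l: "l \<in> L" using F by blast
      have "measure ?M (ball l (R l - C)) \<le> ?q l + e * measure ?M (ball l (R l))"
        unfolding R_def e_def
        by (rule mass_shrunk_ball_le[OF \<alpha> h C]) (use L(4)[OF l] n[OF l] in \<open>auto simp: R_def\<close>)
      then have "ennreal (measure ?M (ball l (R l - C))) \<le> ennreal (?q l + e * measure ?M (ball l (R l)))"
        by (rule ennreal_leI)
      then show "emeasure ?M (ball l (R l - C)) \<le> ennreal (?q l) + ennreal e * emeasure ?M (ball l (R l))"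
        unfolding emeasure_fock_ball_finite[OF \<alpha> h]
        by (simp add: e_def ennreal_plus ennreal_mult sum_nonneg)
    qed
    also have "\<dots> = (\<Sum>l\<in>F. ennreal (?q l)) + ennreal e * (\<Sum>l\<in>F. emeasure ?M (ball l (R l)))"
      by (simp only: sum.distrib sum_distrib_left)
    also have "\<dots> \<le> (\<Sum>\<^sub>\<infinity>l\<in>L. ennreal (?q l)) + ennreal e * (ennreal S * emeasure ?M UNIV)"
    proof (intro add_mono mult_left_mono sum_le_infsum_ennreal F)
      have "(\<Sum>l\<in>F. emeasure ?M (ball l (R l))) \<le> (\<Sum>\<^sub>\<infinity>l\<in>\<Lambda>. emeasure ?M (ball l (R l)))"
        using F L(1) by (intro sum_le_infsum_ennreal) auto
      also have "\<dots> \<le> ennreal S * emeasure ?M (\<Union>l\<in>\<Lambda>. ball l (R l))"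
        unfolding R_def S(2)[symmetric] by (rule infsum_emeasure_le_overlap) simp
      also have "\<dots> \<le> ennreal S * emeasure ?M UNIV"
        by (intro mult_left_mono emeasure_mono) auto
      finally show "(\<Sum>l\<in>F. emeasure ?M (ball l (R l))) \<le> ennreal S * emeasure ?M UNIV" .
    qed simp
    also have "ennreal e * (ennreal S * emeasure ?M UNIV) = ennreal (S * e) * emeasure ?M UNIV"
      using S(1) by (simp add: ennreal_mult e_def mult_ac)
    also have "\<dots> \<le> ennreal (1 / 2) * emeasure ?M UNIV"
      using small by (intro mult_right_mono ennreal_leI) (auto simp: e_def)
    finally show "(\<Sum>l\<in>F. emeasure ?M (ball l (R l - C)))
        \<le> (\<Sum>\<^sub>\<infinity>l\<in>L. ennreal (?q l)) + ennreal (1 / 2) * emeasure ?M UNIV"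
      by (simp add: add_left_mono)
  qed
  finally show ?thesis .
qed

lemma emeasure_split_K: "emeasure (fock_measure \<alpha> f) UNIV
    = emeasure (fock_measure \<alpha> f) K + emeasure (fock_measure \<alpha> f) (UNIV - K)"
  by (subst plus_emeasure) auto

text \<open>Orders of vanishing \<open>m l - 1\<close> are allowed so that one zero can be divided out below.\<close>

lemma mass_outside_le_inside:
  assumes "f \<in> fock \<alpha>" "\<And>l. l \<in> L \<Longrightarrow> m l \<le> Suc (n l)"
    and "\<And>l k. l \<in> L \<Longrightarrow> k < n l \<Longrightarrow> fock_coeff \<alpha> l k f = 0"
  shows "emeasure (fock_measure \<alpha> f) (UNIV - K) \<le> emeasure (fock_measure \<alpha> f) K"
proof -
  let ?M = "fock_measure \<alpha> f"
  have "(\<Sum>\<^sub>\<infinity>l\<in>L. ennreal (\<Sum>k<n l. (norm (fock_coeff \<alpha> l k f))\<^sup>2)) = 0"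
    using assms(3) by (intro infsum_0) simp
  then have *: "emeasure ?M (UNIV - K) \<le> ennreal (1 / 2) * (emeasure ?M K + emeasure ?M (UNIV - K))"
    using mass_outside_le[OF fock_holomorphic[OF \<alpha> assms(1)] assms(2)] by (simp add: emeasure_split_K)
  have "emeasure ?M UNIV < \<infinity>" using assms(1) by (simp add: mem_fock_iff[OF \<alpha>])
  then have "emeasure ?M K < \<infinity>" "emeasure ?M (UNIV - K) < \<infinity>" by (simp_all add: emeasure_split_K)
  then obtain a b where ab: "emeasure ?M K = ennreal a" "emeasure ?M (UNIV - K) = ennreal b" "0 \<le> a" "0 \<le> b"
    using that[of "enn2real (emeasure ?M K)" "enn2real (emeasure ?M (UNIV - K))"] by simp
  then have "ennreal b \<le> ennreal (1 / 2) * ennreal (a + b)"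
    using * by (simp only: ennreal_plus)
  also have "\<dots> = ennreal (1 / 2 * (a + b))" using ab by (intro ennreal_mult[symmetric]) auto
  finally have "b \<le> 1 / 2 * (a + b)" using ab by (subst (asm) ennreal_le_iff) auto
  then have "b \<le> a" by simp
  then show ?thesis using ab by (simp add: ennreal_leI)
qed

text \<open>By finite overlap only finitely many discs contain 0, and any other disc has radius at
  most \<open>norm l\<close>. Bounded centres would thus bound the radii, and the complement of
  \<open>K\<close> would be bounded.\<close>

lemma L_unbounded: "\<exists>l\<in>L. r < norm l"
proof (rule ccontr)
  assume "\<not> ?thesis"
  then have r: "norm l \<le> r" if "l \<in> L" for l using that by force
  define F where "F = {l\<in>\<Lambda>. 0 \<in> ball l (R l)}"
  have "finite F"
  proof (rule ccontr)
    assume "infinite F"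
    obtain n where n: "S < real n" using reals_Archimedean2 by blast
    obtain G where G: "finite G" "card G = n" "G \<subseteq> F"
      using infinite_arbitrarily_large[OF \<open>infinite F\<close>] by blast
    have "ennreal (real n) = (\<Sum>l\<in>G. indicator (ball l (R l)) 0)"
      using G by (simp add: F_def subset_iff flip: ennreal_of_nat_eq_real_of_nat)
    also have "\<dots> \<le> (\<Sum>\<^sub>\<infinity>l\<in>\<Lambda>. indicator (ball l (R l)) 0)"
      using G by (intro sum_le_infsum_ennreal) (auto simp: F_def)
    also have "\<dots> \<le> ennreal S"
      unfolding S(2)[symmetric] overlap_def R_def by (rule SUP_upper) simp
    finally show False using n S(1) by (simp add: ennreal_le_iff)
  qed
  define b where "b = Max (insert r (R ` F))"
  have b: "R l \<le> b" if "l \<in> L" for l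
  proof (cases "l \<in> F")
    case True
    then show ?thesis unfolding b_def using \<open>finite F\<close> by (intro Max_ge) auto
  next
    case False
    then have "R l \<le> norm l" using that L(1) by (auto simp: F_def)
    moreover have "r \<le> b" unfolding b_def using \<open>finite F\<close> by (intro Max_ge) auto
    ultimately show ?thesis using r[OF that] by simp
  qed
  have "UNIV - K \<subseteq> cball 0 (r + b)"
  proof
    fix z assume "z \<in> UNIV - K"
    then obtain l where l: "l \<in> L" "dist l z < R l - C" using cover by (auto simp: L_def R_def)
    have "norm z \<le> norm l + dist l z" using norm_triangle_ineq2[of z l] by (simp add: dist_norm norm_minus_commute)
    then show "z \<in> cball 0 (r + b)" using l b[OF l(1)] r[OF l(1)] C by simp
  qed
  then have "UNIV \<subseteq> K \<union> cball 0 (r + b)" by blast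
  moreover have "bounded (K \<union> cball 0 (r + b))" using K by (simp add: compact_imp_bounded)
  ultimately show False using bounded_subset not_bounded_UNIV by blast
qed

section \<open>Uniqueness: functions vanishing to full order at the centres of the large
  discs\<close>

definition null_space :: "(complex \<Rightarrow> complex) set" where
  "null_space = {f \<in> fock \<alpha>. \<forall>l\<in>L. \<forall>k<m l. fock_coeff \<alpha> l k f = 0}"

text \<open>The function \<open>z * f z / (1 - z / w)\<close> has one zero less than \<open>z * f z\<close>, but lies in the Fock
  space; letting \<open>w\<close> tend to infinity bounds the norm of \<open>z * f z\<close>.\<close>

lemma divided_function:
  assumes f: "f \<in> null_space" and w: "w \<in> L" "w \<noteq> 0"
  obtains h where "h \<in> fock \<alpha>" "\<And>z. (z - w) * h z = - w * (z * f z)"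
    "emeasure (fock_measure \<alpha> h) (UNIV - K) \<le> emeasure (fock_measure \<alpha> h) K"
proof -
  have ff: "f \<in> fock \<alpha>" and fh: "f holomorphic_on UNIV"
    using f fock_holomorphic[OF \<alpha>] by (auto simp: null_space_def)
  have fac: "\<exists>g. g holomorphic_on UNIV \<and> (\<forall>z. f z = (z - l) ^ m l * g z)" if "l \<in> L" for l
    using f that fock_coeff_zero_iff_factor[OF \<alpha> fh, of "m l" l] by (auto simp: null_space_def)
  obtain g where g: "g holomorphic_on UNIV" "\<And>z. f z = (z - w) ^ m w * g z" using fac[OF w(1)] by blast
  \<comment> \<open>The quotient \<open>z * f z / (1 - z / w)\<close>, written as a product so that
    it is visibly entire; \<open>m w\<close> is at least 1.\<close>
  define h where "h z = (z - w) ^ (m w - 1) * (- w * z * g z)" for z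
  have hh: "h holomorphic_on UNIV" unfolding h_def by (intro holomorphic_intros g)
  have eq: "(z - w) * h z = - w * (z * f z)" for z
    using L(3)[OF w(1)] by (simp add: h_def g(2) power_eq_if[of _ "m w"])
  have hf: "h \<in> fock \<alpha>"
  proof -
    \<comment> \<open>Away from \<open>w\<close>, the division by \<open>z - w\<close> absorbs the
      growth of the factor \<open>z\<close>; on the remaining disc every entire function has finite
      mass.\<close>
    have bound: "norm (h z) \<le> (norm w * (1 + norm w)) * norm (f z)" if "z \<in> - ball w 1" for z
    proof -
      have 1: "1 \<le> norm (z - w)" using that by (simp add: dist_norm norm_minus_commute)
      have "norm z \<le> norm (z - w) + norm w" using norm_triangle_ineq[of "z - w" w] by simp
      also have "\<dots> \<le> norm (z - w) * (1 + norm w)"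
        using mult_right_mono[OF 1, of "norm w"] by (simp add: algebra_simps)
      finally have 2: "norm z \<le> norm (z - w) * (1 + norm w)" .
      have "norm (z - w) * norm (h z) = norm w * (norm z * norm (f z))"
        using arg_cong[OF eq[of z], of norm] by (simp add: norm_mult)
      also have "\<dots> \<le> norm w * ((norm (z - w) * (1 + norm w)) * norm (f z))"
        by (intro mult_left_mono mult_right_mono 2) auto
      also have "\<dots> = norm (z - w) * ((norm w * (1 + norm w)) * norm (f z))" by (simp only: mult_ac)
      finally show ?thesis using 1 by (subst (asm) mult_le_cancel_left_pos) auto
    qed
    let ?M = "fock_measure \<alpha> h"
    have "emeasure ?M (- ball w 1) \<le> ennreal ((norm w * (1 + norm w))\<^sup>2) * emeasure (fock_measure \<alpha> f) (- ball w 1)"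
      by (rule emeasure_fock_mono_norm[OF \<alpha> fh hh _ bound]) auto
    also have "\<dots> \<le> ennreal ((norm w * (1 + norm w))\<^sup>2) * emeasure (fock_measure \<alpha> f) UNIV"
      by (intro mult_left_mono emeasure_mono) auto
    also have "\<dots> < \<infinity>" using ff by (simp add: mem_fock_iff[OF \<alpha>] ennreal_mult_less_top)
    finally have "emeasure ?M (- ball w 1) < \<infinity>" .
    moreover have "emeasure ?M (ball w 1) < \<infinity>" by (simp add: emeasure_fock_ball_finite[OF \<alpha> hh])
    moreover have "emeasure ?M UNIV = emeasure ?M (ball w 1) + emeasure ?M (- ball w 1)"
      by (subst plus_emeasure) (auto simp: Compl_partition)
    ultimately show ?thesis using hh by (simp add: mem_fock_iff[OF \<alpha>])
  qed
  define n where "n l = (if l = w then m w - 1 else m l)" for l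
  have "\<forall>k<n l. fock_coeff \<alpha> l k h = 0" if l: "l \<in> L" for l
  proof (cases "l = w")
    case True
    have "\<exists>q. q holomorphic_on UNIV \<and> (\<forall>z. h z = (z - w) ^ (m w - 1) * q z)"
      by (rule exI[of _ "\<lambda>z. - w * z * g z"]) (auto simp: h_def intro!: holomorphic_intros g)
    then show ?thesis using True fock_coeff_zero_iff_factor[OF \<alpha> hh, of "n l" l] by (simp add: n_def)
  next
    case False
    obtain p where p: "p holomorphic_on UNIV" "\<And>z. f z = (z - l) ^ m l * p z" using fac[OF l] by blast
    \<comment> \<open>At a point \<open>l\<close> other than \<open>w\<close>, the zero at
      \<open>w\<close> belongs to the cofactor \<open>p\<close>, so dividing by \<open>z - w\<close>
      leaves the order at \<open>l\<close> intact.\<close>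
    have "f w = 0" using L(3)[OF w(1)] g(2)[of w] by (simp add: power_0_left)
    then have "p w = 0" using p(2)[of w] False by simp
    then obtain q where q: "q holomorphic_on UNIV" "\<And>z. p z = (z - w) * q z"
      using holomorphic_divide_root[OF p(1)] by blast
    have "h = (\<lambda>z. (z - l) ^ m l * (- w * z * q z))"
    proof (rule holomorphic_cancel_root[OF hh])
      show "(z - w) * h z = (z - w) * ((z - l) ^ m l * (- w * z * q z))" for z
        unfolding eq p(2) q(2) by (simp add: mult_ac)
    qed (intro holomorphic_intros q)
    then have "\<exists>q. q holomorphic_on UNIV \<and> (\<forall>z. h z = (z - l) ^ m l * q z)"
      by (intro exI[of _ "\<lambda>z. - w * z * q z"]) (auto intro!: holomorphic_intros q)
    then show ?thesis using False fock_coeff_zero_iff_factor[OF \<alpha> hh, of "n l" l] by (simp add: n_def)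
  qed
  then have "emeasure (fock_measure \<alpha> h) (UNIV - K) \<le> emeasure (fock_measure \<alpha> h) K"
    by (intro mass_outside_le_inside[where n=n, OF hf]) (auto simp: n_def)
  with hf eq that show ?thesis by blast
qed

lemma ident_times_null_space:
  assumes f: "f \<in> null_space"
  shows "(\<lambda>z. z * f z) \<in> null_space"
proof -
  have ff: "f \<in> fock \<alpha>" and fh: "f holomorphic_on UNIV"
    using f fock_holomorphic[OF \<alpha>] by (auto simp: null_space_def)
  have zh: "(\<lambda>z. z * f z) holomorphic_on UNIV" by (intro holomorphic_intros fh)
  have "\<forall>k<m l. fock_coeff \<alpha> l k (\<lambda>z. z * f z) = 0" if l: "l \<in> L" for l
  proof -
    obtain g where g: "g holomorphic_on UNIV" "\<And>z. f z = (z - l) ^ m l * g z"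
      using f l fock_coeff_zero_iff_factor[OF \<alpha> fh, of "m l" l] by (auto simp: null_space_def)
    have "\<exists>q. q holomorphic_on UNIV \<and> (\<forall>z. z * f z = (z - l) ^ m l * q z)"
      by (rule exI[of _ "\<lambda>z. z * g z"]) (auto simp: g(2) intro!: holomorphic_intros g(1))
    then show ?thesis using fock_coeff_zero_iff_factor[OF \<alpha> zh] by blast
  qed
  moreover have "(\<lambda>z. z * f z) \<in> fock \<alpha>"
  proof -
    obtain \<rho> where \<rho>: "0 < \<rho>" "\<And>z. z \<in> K \<Longrightarrow> norm z \<le> \<rho>"
      using compact_imp_bounded[OF K] bounded_pos by blast
    let ?Mf = "emeasure (fock_measure \<alpha> f) UNIV"
    \<comment> \<open>The factors come from \<open>norm (z * f z) <= 2 * norm (h z)\<close> on the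
      ball, from the mass of \<open>h\<close> being at most twice its mass on \<open>K\<close>, and
      from \<open>norm (h z) <= 2 * \<rho> * norm (f z)\<close> on \<open>K\<close>. None depends on
      \<open>N\<close> or \<open>w\<close>.\<close>
    define B where "B = ennreal (2\<^sup>2) * (2 * (ennreal ((2 * \<rho>)\<^sup>2) * ?Mf))"
    have "emeasure (fock_measure \<alpha> (\<lambda>z. z * f z)) UNIV \<le> B"
    proof (rule emeasure_UNIV_le_of_balls)
      fix N
      \<comment> \<open>Beyond \<open>2 * \<rho>\<close>, so that \<open>norm (1 - z / w)\<close> is
        at least 1/2 on \<open>K\<close>; beyond \<open>N\<close>, so that it is at most 2 on the
        ball.\<close>
      obtain w where w: "w \<in> L" "max (2 * \<rho>) (real N) < norm w" using L_unbounded by blast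
      then have w0: "w \<noteq> 0" "2 * \<rho> < norm w" "real N < norm w" using \<rho>(1) by auto
      obtain h where h: "h \<in> fock \<alpha>" "\<And>z. (z - w) * h z = - w * (z * f z)"
        "emeasure (fock_measure \<alpha> h) (UNIV - K) \<le> emeasure (fock_measure \<alpha> h) K"
        using divided_function[OF f w(1) w0(1)] by blast
      note hh = fock_holomorphic[OF \<alpha> h(1)]
      have eqn: "norm (z - w) * norm (h z) = norm w * (norm z * norm (f z))" for z
        using arg_cong[OF h(2)[of z], of norm] by (simp add: norm_mult)
      have inK: "norm (h z) \<le> 2 * \<rho> * norm (f z)" if "z \<in> K" for z
      proof -
        have "norm w / 2 \<le> norm (z - w)"
          using norm_triangle_ineq2[of w z] \<rho>(2)[OF that] w0(2) by (simp add: norm_minus_commute)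
        then have "norm w / 2 * norm (h z) \<le> norm w * (norm z * norm (f z))"
          unfolding eqn[symmetric] by (rule mult_right_mono) simp
        also have "\<dots> \<le> norm w * (\<rho> * norm (f z))"
          by (intro mult_left_mono mult_right_mono \<rho>(2)[OF that]) auto
        finally have "norm w * norm (h z) \<le> norm w * (2 * \<rho> * norm (f z))" by simp
        then show ?thesis using w0(1) by (subst (asm) mult_le_cancel_left_pos) auto
      qed
      have inball: "norm (z * f z) \<le> 2 * norm (h z)" if "z \<in> ball 0 (real N)" for z
      proof -
        have "norm (z - w) \<le> 2 * norm w"
          using norm_triangle_ineq4[of z w] that w0(3) by simp
        then have "norm w * norm (z * f z) \<le> norm w * (2 * norm (h z))"
          using mult_right_mono[of "norm (z - w)" "2 * norm w" "norm (h z)"] eqn[of z]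
          by (simp add: norm_mult mult_ac)
        then show ?thesis using w0(1) by (subst (asm) mult_le_cancel_left_pos) auto
      qed
      have "emeasure (fock_measure \<alpha> (\<lambda>z. z * f z)) (ball 0 (real N))
          \<le> ennreal (2\<^sup>2) * emeasure (fock_measure \<alpha> h) (ball 0 (real N))"
        by (rule emeasure_fock_mono_norm[OF \<alpha> hh zh _ inball]) auto
      also have "\<dots> \<le> ennreal (2\<^sup>2) * emeasure (fock_measure \<alpha> h) UNIV"
        by (intro mult_left_mono emeasure_mono) auto
      also have "emeasure (fock_measure \<alpha> h) UNIV \<le> 2 * emeasure (fock_measure \<alpha> h) K"
        unfolding emeasure_split_K mult_2 by (intro add_left_mono h)
      also have "emeasure (fock_measure \<alpha> h) K \<le> ennreal ((2 * \<rho>)\<^sup>2) * emeasure (fock_measure \<alpha> f) K"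
        by (rule emeasure_fock_mono_norm[OF \<alpha> fh hh _ inK]) auto
      also have "emeasure (fock_measure \<alpha> f) K \<le> ?Mf"
        by (intro emeasure_mono) auto
      finally show "emeasure (fock_measure \<alpha> (\<lambda>z. z * f z)) (ball 0 (real N)) \<le> B"
        unfolding B_def by (simp add: mult_left_mono)
    qed simp
    also have "B < \<infinity>"
      using ff by (simp add: B_def mem_fock_iff[OF \<alpha>] ennreal_mult_less_top)
    finally show ?thesis using zh by (simp add: mem_fock_iff[OF \<alpha>])
  qed
  ultimately show ?thesis by (auto simp: null_space_def)
qed

text \<open>Multiplication by \<open>z ^ p\<close> moves the mass away from \<open>K\<close>, while for members of the null
  space at least half of it stays in \<open>K\<close>.\<close>

lemma null_space_trivial:
  assumes f: "f \<in> null_space"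
  shows "f = (\<lambda>_. 0)"
proof -
  have ff: "f \<in> fock \<alpha>" and fh: "f holomorphic_on UNIV"
    using f fock_holomorphic[OF \<alpha>] by (auto simp: null_space_def)
  have pw: "(\<lambda>z. z ^ p * f z) \<in> null_space" for p
  proof (induction p)
    case (Suc p)
    show ?case using ident_times_null_space[OF Suc] by (simp add: mult.assoc)
  qed (use f in simp)
  obtain \<rho> where \<rho>: "0 < \<rho>" "\<And>z. z \<in> K \<Longrightarrow> norm z \<le> \<rho>"
    using compact_imp_bounded[OF K] bounded_pos by blast
  \<comment> \<open>A unit disc on which \<open>norm z >= 2 * \<rho>\<close>, hence disjoint from
    \<open>K\<close>: multiplication by \<open>z ^ p\<close> favours its mass over that of
    \<open>K\<close> by a factor of at least \<open>4 ^ p\<close>.\<close>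
  define A where "A = ball (complex_of_real (2 * \<rho> + 1)) 1"
  have A: "2 * \<rho> \<le> norm z" if "z \<in> A" for z
    using that norm_triangle_ineq2[of "complex_of_real (2 * \<rho> + 1)" z] \<rho>(1)
    by (simp add: A_def dist_norm del: of_real_add of_real_mult)
  obtain y where y: "emeasure (fock_measure \<alpha> f) UNIV = ennreal y" "0 \<le> y"
    using emeasure_fock_UNIV[OF \<alpha> ff] fock_norm2_nonneg[OF \<alpha>] by blast
  have le: "measure (fock_measure \<alpha> f) A \<le> (1 / 4) ^ p * y" for p
  proof -
    let ?g = "\<lambda>z. z ^ p * f z"
    have g: "?g \<in> fock \<alpha>" using pw by (simp add: null_space_def)
    note gh = fock_holomorphic[OF \<alpha> g]
    have "emeasure (fock_measure \<alpha> f) A \<le> ennreal (((1 / (2 * \<rho>)) ^ p)\<^sup>2) * emeasure (fock_measure \<alpha> ?g) A"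
    proof (rule emeasure_fock_mono_norm[OF \<alpha> gh fh])
      fix z assume "z \<in> A"
      then have "1 \<le> (1 / (2 * \<rho>) * norm z) ^ p" using A[of z] \<rho>(1) by (intro one_le_power) (simp add: field_simps)
      then have "1 * norm (f z) \<le> (1 / (2 * \<rho>) * norm z) ^ p * norm (f z)" by (rule mult_right_mono) simp
      then show "norm (f z) \<le> (1 / (2 * \<rho>)) ^ p * norm (z ^ p * f z)"
        by (simp add: norm_mult norm_power power_mult_distrib mult_ac power_divide)
    qed (simp add: A_def)
    also have "emeasure (fock_measure \<alpha> ?g) A \<le> emeasure (fock_measure \<alpha> ?g) (UNIV - K)"
    proof (rule emeasure_mono)
      show "A \<subseteq> UNIV - K"
      proof
        fix z assume "z \<in> A"
        with A[of z] \<rho>(1) \<rho>(2)[of z] show "z \<in> UNIV - K" by auto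
      qed
    qed simp
    also have "\<dots> \<le> emeasure (fock_measure \<alpha> ?g) K"
      using pw[of p] by (intro mass_outside_le_inside[where n=m] g) (auto simp: null_space_def)
    also have "\<dots> \<le> ennreal ((\<rho> ^ p)\<^sup>2) * emeasure (fock_measure \<alpha> f) K"
    proof (rule emeasure_fock_mono_norm[OF \<alpha> fh gh])
      fix z assume "z \<in> K"
      then show "norm (z ^ p * f z) \<le> \<rho> ^ p * norm (f z)"
        by (auto simp: norm_mult norm_power intro!: mult_right_mono power_mono \<rho>)
    qed simp
    also have "emeasure (fock_measure \<alpha> f) K \<le> emeasure (fock_measure \<alpha> f) UNIV"
      by (intro emeasure_mono) auto
    finally have "emeasure (fock_measure \<alpha> f) A
        \<le> ennreal (((1 / (2 * \<rho>)) ^ p)\<^sup>2) * (ennreal ((\<rho> ^ p)\<^sup>2) * ennreal y)"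
      unfolding y by (simp add: mult_left_mono)
    also have "\<dots> = ennreal (((1 / (2 * \<rho>)) ^ p)\<^sup>2 * ((\<rho> ^ p)\<^sup>2 * y))"
      using y by (simp add: ennreal_mult)
    also have "((1 / (2 * \<rho>)) ^ p)\<^sup>2 * ((\<rho> ^ p)\<^sup>2 * y) = (((1 / (2 * \<rho>) * \<rho>)\<^sup>2) ^ p) * y"
    proof -
      have "(a ^ p)\<^sup>2 * (b ^ p)\<^sup>2 = ((a * b)\<^sup>2) ^ p" for a b :: real
        unfolding power_mult[symmetric] mult.commute[of p 2] power_mult_distrib ..
      then show ?thesis by (simp only: mult.assoc[symmetric])
    qed
    also have "(1 / (2 * \<rho>) * \<rho>)\<^sup>2 = 1 / 4" using \<rho>(1) by (simp add: power2_eq_square)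
    finally show ?thesis
      using y unfolding A_def emeasure_fock_ball_finite[OF \<alpha> fh] by (subst (asm) ennreal_le_iff) auto
  qed
  have "measure (fock_measure \<alpha> f) A \<le> 0"
  proof (rule LIMSEQ_le_const)
    have "(\<lambda>p. (1 / 4 :: real) ^ p * y) \<longlonglongrightarrow> 0 * y"
      by (intro tendsto_intros LIMSEQ_realpow_zero) auto
    then show "(\<lambda>p. (1 / 4 :: real) ^ p * y) \<longlonglongrightarrow> 0" by simp
  qed (use le in blast)
  then have "measure (fock_measure \<alpha> f) A = 0" by (simp add: measure_le_0_iff)
  then have "emeasure (fock_measure \<alpha> f) A = 0" unfolding A_def emeasure_fock_ball_finite[OF \<alpha> fh] by simp
  then show ?thesis unfolding A_def by (rule fock_null_ball_imp_zero[OF \<alpha> fh, rotated]) simp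
qed

section \<open>The sampling inequalities, the lower one by compactness\<close>

lemma norm_le_inside_plus_quotients:
  assumes f: "f \<in> fock \<alpha>" and s: "0 \<le> s"
    "(\<Sum>\<^sub>\<infinity>l\<in>\<Lambda>. ennreal (quotient_norm2 \<alpha> l (m l) f)) \<le> ennreal s"
  shows "fock_norm2 \<alpha> f \<le> 2 * measure (fock_measure \<alpha> f) K + 2 * s"
proof -
  let ?M = "fock_measure \<alpha> f"
  have fin: "emeasure ?M UNIV = ennreal (fock_norm2 \<alpha> f)" by (rule emeasure_fock_UNIV[OF \<alpha> f])
  have "emeasure ?M K \<le> emeasure ?M UNIV" by (intro emeasure_mono) auto
  then have MK: "emeasure ?M K = ennreal (measure ?M K)"
    using fin by (intro emeasure_eq_ennreal_measure) (auto simp: top_unique)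
  have "(\<Sum>\<^sub>\<infinity>l\<in>L. ennreal (\<Sum>k<m l. (norm (fock_coeff \<alpha> l k f))\<^sup>2)) \<le> ennreal s"
  proof (rule infsum_ennreal_le)
    fix F assume "finite F" "F \<subseteq> L"
    then have "(\<Sum>l\<in>F. ennreal (quotient_norm2 \<alpha> l (m l) f)) \<le> (\<Sum>\<^sub>\<infinity>l\<in>\<Lambda>. ennreal (quotient_norm2 \<alpha> l (m l) f))"
      using L(1) by (intro sum_le_infsum_ennreal) auto
    also note s(2)
    finally show "(\<Sum>l\<in>F. ennreal (\<Sum>k<m l. (norm (fock_coeff \<alpha> l k f))\<^sup>2)) \<le> ennreal s"
      by (simp add: quotient_norm2_eq[OF \<alpha> f])
  qed
  then have "emeasure ?M (UNIV - K) \<le> ennreal s + ennreal (1 / 2) * emeasure ?M UNIV"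
    using mass_outside_le[OF fock_holomorphic[OF \<alpha> f], of m] by (auto intro: order_trans add_right_mono)
  then have "emeasure ?M UNIV \<le> ennreal (measure ?M K) + (ennreal s + ennreal (1 / 2) * emeasure ?M UNIV)"
    by (simp add: emeasure_split_K[of f, symmetric] MK[symmetric]) (subst emeasure_split_K, rule add_left_mono, assumption)
  also have "\<dots> = ennreal (measure ?M K + (s + 1 / 2 * fock_norm2 \<alpha> f))"
    unfolding fin using s fock_norm2_nonneg[OF \<alpha>, of f] by (simp only: ennreal_plus ennreal_mult measure_nonneg
        add_nonneg_nonneg mult_nonneg_nonneg)
  finally have "fock_norm2 \<alpha> f \<le> measure ?M K + (s + 1 / 2 * fock_norm2 \<alpha> f)"
    unfolding fin using s fock_norm2_nonneg[OF \<alpha>, of f] by (subst (asm) ennreal_le_iff) auto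
  then show ?thesis by simp
qed

text \<open>Without a lower bound there are normalized functions whose quotient sums tend to 0, and
  these keep asymptotically at least half of their mass on \<open>K\<close>. A locally uniform limit
  retains that mass, as \<open>K\<close> is compact, but lies in \<open>null_space\<close> and so
  vanishes.\<close>

lemma sampling_lower_bound:
  "\<exists>c>0. \<forall>f\<in>fock \<alpha>. ennreal (c * fock_norm2 \<alpha> f) \<le> (\<Sum>\<^sub>\<infinity>l\<in>\<Lambda>. ennreal (quotient_norm2 \<alpha> l (m l) f))"
proof (rule ccontr)
  let ?Q = "\<lambda>f. \<Sum>\<^sub>\<infinity>l\<in>\<Lambda>. ennreal (quotient_norm2 \<alpha> l (m l) f)"
  define \<epsilon> where "\<epsilon> n = inverse (real (Suc n))" for n
  have \<epsilon>: "0 < \<epsilon> n" for n by (simp add: \<epsilon>_def)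
  assume "\<not> ?thesis"
  then have "\<exists>f\<in>fock \<alpha>. ?Q f < ennreal (\<epsilon> n * fock_norm2 \<alpha> f)" for n
    using \<epsilon>[of n] by (meson not_less)
  then obtain f where f: "\<And>n. f n \<in> fock \<alpha>" "\<And>n. ?Q (f n) < ennreal (\<epsilon> n * fock_norm2 \<alpha> (f n))"
    by metis
  define N where "N n = fock_norm2 \<alpha> (f n)" for n
  \<comment> \<open>The negated inequality is strict, and nothing in \<open>ennreal\<close> lies
    below 0.\<close>
  have N: "0 < N n" for n
  proof (rule ccontr)
    assume "\<not> 0 < N n"
    then have "\<epsilon> n * fock_norm2 \<alpha> (f n) \<le> 0" using \<epsilon>[of n] by (simp add: N_def mult_le_0_iff)
    with f(2)[of n] show False by (simp add: ennreal_neg)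
  qed
  define g where "g n z = complex_of_real (1 / sqrt (N n)) * f n z" for n z
  have g: "g n \<in> fock \<alpha>" for n unfolding g_def[abs_def] by (rule fock_cmult(1)[OF \<alpha> f(1)])
  note gh = fock_holomorphic[OF \<alpha> g] and fh = fock_holomorphic[OF \<alpha> f(1)]
  have g1: "emeasure (fock_measure \<alpha> (g n)) UNIV \<le> 1" for n
  proof -
    have "emeasure (fock_measure \<alpha> (g n)) UNIV \<le> ennreal ((1 / sqrt (N n))\<^sup>2) * emeasure (fock_measure \<alpha> (f n)) UNIV"
      by (rule emeasure_fock_mono_norm[OF \<alpha> fh gh])
         (use N[of n] in \<open>auto simp: g_def norm_mult norm_divide\<close>)
    also have "\<dots> = ennreal ((1 / sqrt (N n))\<^sup>2 * N n)"
      unfolding emeasure_fock_UNIV[OF \<alpha> f(1)] N_def[symmetric] using N[of n] by (simp add: ennreal_mult)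
    also have "(1 / sqrt (N n))\<^sup>2 * N n = 1" using N[of n] by (simp add: power_divide)
    finally show ?thesis by simp
  qed
  have gK: "ennreal (1 - 2 * \<epsilon> n) \<le> 2 * emeasure (fock_measure \<alpha> (g n)) K" for n
  proof -
    have le1: "emeasure (fock_measure \<alpha> h) K \<le> emeasure (fock_measure \<alpha> h) UNIV" for h
      by (intro emeasure_mono) auto
    have gKm: "emeasure (fock_measure \<alpha> (g n)) K = ennreal (measure (fock_measure \<alpha> (g n)) K)"
      using order_trans[OF le1 g1[of n]] by (intro emeasure_eq_ennreal_measure) (auto simp: top_unique)
    have fKm: "emeasure (fock_measure \<alpha> (f n)) K = ennreal (measure (fock_measure \<alpha> (f n)) K)"
      using le1[of "f n"] unfolding emeasure_fock_UNIV[OF \<alpha> f(1)]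
      by (intro emeasure_eq_ennreal_measure) (auto simp: top_unique)
    have "N n \<le> 2 * measure (fock_measure \<alpha> (f n)) K + 2 * (\<epsilon> n * N n)"
      unfolding N_def
      by (rule norm_le_inside_plus_quotients[OF f(1)])
         (use f(2)[of n] \<epsilon>[of n] fock_norm2_nonneg[OF \<alpha>] in \<open>auto intro: less_imp_le\<close>)
    moreover have "measure (fock_measure \<alpha> (f n)) K \<le> N n * measure (fock_measure \<alpha> (g n)) K"
    proof -
      have "emeasure (fock_measure \<alpha> (f n)) K \<le> ennreal ((sqrt (N n))\<^sup>2) * emeasure (fock_measure \<alpha> (g n)) K"
        by (rule emeasure_fock_mono_norm[OF \<alpha> gh fh])
           (use N[of n] in \<open>auto simp: g_def norm_mult norm_divide\<close>)
      also have "\<dots> = ennreal (N n * measure (fock_measure \<alpha> (g n)) K)"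
        using N[of n] unfolding gKm by (simp add: ennreal_mult)
      finally show ?thesis unfolding fKm using N[of n] by (subst (asm) ennreal_le_iff) auto
    qed
    ultimately have "N n * 1 \<le> N n * (2 * measure (fock_measure \<alpha> (g n)) K + 2 * \<epsilon> n)"
      by (simp add: algebra_simps)
    then have "1 - 2 * \<epsilon> n \<le> 2 * measure (fock_measure \<alpha> (g n)) K"
      using N[of n] by (subst (asm) mult_le_cancel_left_pos) auto
    then have "ennreal (1 - 2 * \<epsilon> n) \<le> ennreal (2 * measure (fock_measure \<alpha> (g n)) K)" by (rule ennreal_leI)
    then show ?thesis unfolding gKm by (simp add: ennreal_mult')
  qed
  have gc: "(norm (fock_coeff \<alpha> l k (g n)))\<^sup>2 \<le> \<epsilon> n" if "l \<in> \<Lambda>" "k < m l" for l k n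
  proof -
    have "(norm (fock_coeff \<alpha> l k (f n)))\<^sup>2 \<le> quotient_norm2 \<alpha> l (m l) (f n)"
      unfolding quotient_norm2_eq[OF \<alpha> f(1)] using that by (intro member_le_sum) auto
    then have "ennreal ((norm (fock_coeff \<alpha> l k (f n)))\<^sup>2) \<le> ennreal (quotient_norm2 \<alpha> l (m l) (f n))"
      by (rule ennreal_leI)
    also have "\<dots> \<le> ?Q (f n)"
      using sum_le_infsum_ennreal[of "{l}" \<Lambda>] that by simp
    also have "\<dots> \<le> ennreal (\<epsilon> n * N n)" unfolding N_def by (rule less_imp_le[OF f(2)])
    finally have "(norm (fock_coeff \<alpha> l k (f n)))\<^sup>2 \<le> \<epsilon> n * N n"
      using \<epsilon>[of n] N[of n] by (subst (asm) ennreal_le_iff) auto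
    then show ?thesis
      unfolding g_def[abs_def] fock_cmult(2)[OF \<alpha> f(1)] using N[of n]
      by (simp add: norm_mult norm_divide power_mult_distrib power_divide field_simps)
  qed
  have bound: "norm (g n z) \<le> sqrt (2 * exp (\<alpha> * r\<^sup>2))" if "norm z \<le> r" for n z r
  proof (rule real_le_rsqrt)
    have "(norm (g n z))\<^sup>2 \<le> 2 * exp (\<alpha> * (norm z)\<^sup>2)" by (rule fock_pointwise_bound[OF \<alpha> gh g1])
    also have "\<dots> \<le> 2 * exp (\<alpha> * r\<^sup>2)" using that \<alpha> by (auto intro!: mult_left_mono power_mono)
    finally show "(norm (g n z))\<^sup>2 \<le> 2 * exp (\<alpha> * r\<^sup>2)" .
  qed
  obtain G r where G: "G holomorphic_on UNIV" "strict_mono (r :: nat \<Rightarrow> nat)"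
    "\<And>z. (\<lambda>n. g (r n) z) \<longlonglongrightarrow> G z"
    "\<And>A. compact A \<Longrightarrow> uniform_limit A (g \<circ> r) G sequentially"
  proof (rule Montel[of UNIV "range g" g])
    show "h holomorphic_on UNIV" if "h \<in> range g" for h using that gh by blast
    fix A :: "complex set" assume "compact A"
    then have "bounded A" by (rule compact_imp_bounded)
    then obtain \<rho> where "\<forall>z\<in>A. norm z \<le> \<rho>" unfolding bounded_iff by blast
    then show "\<exists>B. \<forall>h\<in>range g. \<forall>z\<in>A. norm (h z) \<le> B"
      using bound by (intro exI[of _ "sqrt (2 * exp (\<alpha> * \<rho>\<^sup>2))"]) auto
  qed (use that in simp_all)
  have \<epsilon>0: "(\<lambda>n. \<epsilon> (r n)) \<longlonglongrightarrow> 0"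
    using LIMSEQ_subseq_LIMSEQ[OF LIMSEQ_inverse_real_of_nat G(2)] by (simp add: \<epsilon>_def[abs_def] o_def)
  have mass: "(\<lambda>n. emeasure (fock_measure \<alpha> (g (r n))) A) \<longlonglongrightarrow> emeasure (fock_measure \<alpha> G) A"
    if A: "A \<in> sets borel" "bounded A" for A
  proof -
    obtain \<rho> where "\<forall>z\<in>A. norm z \<le> \<rho>" using A(2) unfolding bounded_iff by blast
    then have b: "norm (g (r n) z) \<le> sqrt (2 * exp (\<alpha> * \<rho>\<^sup>2))" if "z \<in> A" for n z
      using that by (intro bound) blast
    show ?thesis
      by (rule fock_mass_tendsto[where g="\<lambda>n. g (r n)", OF \<alpha> gh G(1) A(1) b G(3)])
  qed
  \<comment> \<open>Mass may escape to infinity in the limit but cannot be created, so a bound on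
    discs is enough.\<close>
  have "emeasure (fock_measure \<alpha> G) UNIV \<le> 1"
  proof (rule emeasure_UNIV_le_of_balls)
    fix n
    have le1: "emeasure (fock_measure \<alpha> (g (r i))) (ball 0 (real n)) \<le> 1" for i
      by (rule order_trans[OF emeasure_mono g1]) auto
    show "emeasure (fock_measure \<alpha> G) (ball 0 (real n)) \<le> 1"
      by (rule LIMSEQ_le_const2[OF mass]) (use le1 in \<open>auto intro: bounded_ball\<close>)
  qed simp
  then have GF: "G \<in> fock \<alpha>" using G(1) by (auto simp: mem_fock_iff[OF \<alpha>] intro: le_less_trans)
  have "fock_coeff \<alpha> l k G = 0" if l: "l \<in> L" "k < m l" for l k
  proof -
    have l': "l \<in> \<Lambda>" using l L(1) by blast
    have "(\<lambda>n. fock_coeff \<alpha> l k (g (r n))) \<longlonglongrightarrow> fock_coeff \<alpha> l k G"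
      using G(4)[of "cball l 1"] by (intro fock_coeff_tendsto[where g="\<lambda>n. g (r n)"] gh) (simp add: o_def)
    then have "(\<lambda>n. (norm (fock_coeff \<alpha> l k (g (r n))))\<^sup>2) \<longlonglongrightarrow> (norm (fock_coeff \<alpha> l k G))\<^sup>2"
      by (intro tendsto_intros)
    then have "(norm (fock_coeff \<alpha> l k G))\<^sup>2 \<le> 0"
      by (rule LIMSEQ_le[OF _ \<epsilon>0]) (use gc[OF l' l(2)] in auto)
    then show ?thesis by simp
  qed
  then have "G \<in> null_space" using GF by (simp add: null_space_def)
  then have "G = (\<lambda>_. 0)" by (rule null_space_trivial)
  then have "emeasure (fock_measure \<alpha> G) K = 0"
    by (simp add: emeasure_fock_measure[OF \<alpha>])
  then have lim1: "(\<lambda>n. 2 * emeasure (fock_measure \<alpha> (g (r n))) K) \<longlonglongrightarrow> 2 * 0"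
    using mass[of K] K by (intro ennreal_tendsto_cmult) (auto simp: compact_imp_bounded)
  have lim2: "(\<lambda>n. ennreal (1 - 2 * \<epsilon> (r n))) \<longlonglongrightarrow> ennreal (1 - 2 * 0)"
    by (intro tendsto_ennrealI tendsto_intros \<epsilon>0)
  have "ennreal (1 - 2 * 0) \<le> 2 * 0"
    by (rule LIMSEQ_le[OF lim2 lim1]) (use gK in auto)
  then show False by simp
qed

lemma sampling: "sampling_divisor \<alpha> \<Lambda> m"
proof -
  obtain c where c: "0 < c" "\<And>f. f \<in> fock \<alpha> \<Longrightarrow>
      ennreal (c * fock_norm2 \<alpha> f) \<le> (\<Sum>\<^sub>\<infinity>l\<in>\<Lambda>. ennreal (quotient_norm2 \<alpha> l (m l) f))"
    using sampling_lower_bound by blast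
  \<comment> \<open>The estimate itself gives the constant \<open>2 * S\<close>; the maximum secures
    that the lower constant does not exceed the upper one.\<close>
  have "(\<Sum>\<^sub>\<infinity>l\<in>\<Lambda>. ennreal (quotient_norm2 \<alpha> l (m l) f)) \<le> ennreal (max c (2 * S) * fock_norm2 \<alpha> f)"
    if f: "f \<in> fock \<alpha>" for f
  proof -
    have "(\<Sum>\<^sub>\<infinity>l\<in>\<Lambda>. ennreal (quotient_norm2 \<alpha> l (m l) f))
        \<le> 2 * (ennreal S * emeasure (fock_measure \<alpha> f) (\<Union>l\<in>\<Lambda>. ball l (sqrt (real (m l) / \<alpha>))))"
      using infsum_quotient_norm2_le[OF \<alpha> f div] by (simp add: S)
    also have "\<dots> \<le> 2 * (ennreal S * emeasure (fock_measure \<alpha> f) UNIV)"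
      by (intro mult_left_mono emeasure_mono) auto
    also have "\<dots> = ennreal (2 * S * fock_norm2 \<alpha> f)"
      unfolding emeasure_fock_UNIV[OF \<alpha> f] using S(1) fock_norm2_nonneg[OF \<alpha>, of f]
      by (simp add: ennreal_mult mult.assoc)
    also have "\<dots> \<le> ennreal (max c (2 * S) * fock_norm2 \<alpha> f)"
      by (intro ennreal_leI mult_right_mono fock_norm2_nonneg[OF \<alpha>]) simp
    finally show ?thesis .
  qed
  with c div show ?thesis
    unfolding sampling_divisor_def by (intro conjI exI[of _ c] exI[of _ "max c (2 * S)"]) auto
qed

end

theorem theorem1p1:
  fixes \<alpha> :: real
  assumes "\<alpha> > 0"
  shows
    "(\<forall>\<Lambda> m. divisor \<Lambda> m \<longrightarrow> sampling_divisor \<alpha> \<Lambda> m \<longrightarrow>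
        finite_overlap \<alpha> \<Lambda> m \<and>
        (\<exists>C>0. (\<Union>l\<in>\<Lambda>. ball l (sqrt (real (m l) / \<alpha>) + C)) = UNIV)) \<and>
     (\<exists>C :: ennreal \<Rightarrow> real. (\<forall>S. C S > 0) \<and>
        (\<forall>\<Lambda> m. divisor \<Lambda> m \<longrightarrow> finite_overlap \<alpha> \<Lambda> m \<longrightarrow>
          (\<exists>K. compact K \<and>
            (\<Union>l\<in>{l\<in>\<Lambda>. real (m l) > \<alpha> * (C (overlap \<alpha> \<Lambda> m))\<^sup>2}.
               ball l (sqrt (real (m l) / \<alpha>) - C (overlap \<alpha> \<Lambda> m))) = UNIV - K) \<longrightarrow>
          sampling_divisor \<alpha> \<Lambda> m))"
proof (rule conjI)
  show "\<forall>\<Lambda> m. divisor \<Lambda> m \<longrightarrow> sampling_divisor \<alpha> \<Lambda> m \<longrightarrow>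
        finite_overlap \<alpha> \<Lambda> m \<and>
        (\<exists>C>0. (\<Union>l\<in>\<Lambda>. ball l (sqrt (real (m l) / \<alpha>) + C)) = UNIV)"
    using sampling_imp_finite_overlap[OF assms] sampling_imp_cover[OF assms] by blast
next
  \<comment> \<open>This gives \<open>\<alpha> * C^2 = S + 1\<close>, and
    \<open>exp (2 * S + 2) >= 2 * S\<close> is the required smallness. The summand 1 keeps
    \<open>C\<close> positive at overlap 0 and also at infinity, which \<open>enn2real\<close> sends
    to 0.\<close>
  define C where "C S = sqrt ((enn2real S + 1) / \<alpha>)" for S
  have pos: "C S > 0" for S
    unfolding C_def using assms by (intro real_sqrt_gt_zero divide_pos_pos add_nonneg_pos) auto
  have "sampling_divisor \<alpha> \<Lambda> m"
    if *: "divisor \<Lambda> m" "finite_overlap \<alpha> \<Lambda> m" "compact K"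
      "(\<Union>l\<in>{l\<in>\<Lambda>. real (m l) > \<alpha> * (C (overlap \<alpha> \<Lambda> m))\<^sup>2}.
         ball l (sqrt (real (m l) / \<alpha>) - C (overlap \<alpha> \<Lambda> m))) = UNIV - K" for \<Lambda> m K
  proof -
    define S where "S = enn2real (overlap \<alpha> \<Lambda> m)"
    have S: "0 \<le> S" "overlap \<alpha> \<Lambda> m = ennreal S"
      using *(2) by (auto simp: S_def finite_overlap_def)
    have "\<alpha> * (C (overlap \<alpha> \<Lambda> m))\<^sup>2 = S + 1"
      using assms S(1) by (simp add: C_def S_def)
    then have e: "- 2 * \<alpha> * (C (overlap \<alpha> \<Lambda> m))\<^sup>2 = - (2 * S + 2)" by simp
    have "2 * S \<le> exp (2 * S + 2)" using exp_ge_add_one_self[of "2 * S + 2"] by linarith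
    then have "S * exp (- 2 * \<alpha> * (C (overlap \<alpha> \<Lambda> m))\<^sup>2) \<le> 1 / 2"
      unfolding e exp_minus by (simp add: field_simps)
    then interpret large_disc_cover \<alpha> "C (overlap \<alpha> \<Lambda> m)" S \<Lambda> m K
      using assms pos S * by unfold_locales auto
    show ?thesis by (rule sampling)
  qed
  with pos show "\<exists>C :: ennreal \<Rightarrow> real. (\<forall>S. C S > 0) \<and>
        (\<forall>\<Lambda> m. divisor \<Lambda> m \<longrightarrow> finite_overlap \<alpha> \<Lambda> m \<longrightarrow>
          (\<exists>K. compact K \<and>
            (\<Union>l\<in>{l\<in>\<Lambda>. real (m l) > \<alpha> * (C (overlap \<alpha> \<Lambda> m))\<^sup>2}.
               ball l (sqrt (real (m l) / \<alpha>) - C (overlap \<alpha> \<Lambda> m))) = UNIV - K) \<longrightarrow>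
          sampling_divisor \<alpha> \<Lambda> m)"
    by blast
qed

end
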